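(* Let $|\mathcal U|\ge 4$, let $\mathcal D\subseteq\mathcal R$ be a rich domain, and let $f\colon\mathcal D^N\to\mathcal R$ be an anonymous Arrovian social welfare function. Then $\mathcal D\subseteq\mathcal R^{pc}$.
   Context: Outcomes. $\mathcal U$ is a non-empty finite set of alternatives; $\Delta$ is the set of all probability measures on $\mathcal U$, with the Euclidean topology inherited from $\mathbb R^{\mathcal U}$. Each $a\in\mathcal U$ is identified with the point mass on $a$ (a pure outcome). For $X\subseteq\mathcal U$, $\Delta_X=\{p\in\Delta: p(X)=1\}$. For $p,q\in\Delta$, $\lambda\in[0,1]$, $p\lambda q=\lambda p+(1-\lambda)q$. Preferences. A preference relation is an asymmetric binary relation $\succ$ on $\Delta$; $p\sim q$ means neither $p\succ q$ nor $q\succ p$; $p\succsim q$ means $p\succ q$ or $p\sim q$. $U(p)=\{q: q\succ p\}$, $L(p)=\{q: p\succ q\}$, $I(p)=\{q: p\sim q\}$. For a set $X$ of outcomes, ${\succ}|_X=\{(p,q)\in{\succ}: p,q\in X\}$. $\mathcal R$ is the set of preference relations satisfying, for all $p$: (continuity) $U(p)$ and $L(p)$ are open in $\Delta$; (convexity) $U(p)$, $L(p)$, $U(p)\cup I(p)$, $L(p)\cup I(p)$ are convex; and (symmetry) for all $p,q,r\in\Delta$, $\lambda\in(0,1)$: if $q\sim\frac12p+\frac12r$ and $p\lambda r\sim\frac12p+\frac12q$, then $r\lambda p\sim\frac12r+\frac12q$. The empty relation $\emptyset$ is complete indifference. SSB functions. An SSB function is a map $\phi\colon\Delta\times\Delta\to\mathbb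 R$ with $\phi(p,q)=-\phi(q,p)$ that is linear (i.e. preserves convex combinations) in each argument; it represents $\succ$ (written ${\succ}\equiv\phi$) if $p\succ q\Leftrightarrow\phi(p,q)>0$ for all $p,q$. Every ${\succ}\in\mathcal R$ is represented by an SSB function, unique up to multiplication by a positive scalar. $\Phi$ is the set of SSB functions whose largest value is $1$, together with the zero function (which represents $\emptyset$). $\Phi^{pc}$ is the set of $\phi\in\Phi$ with $\phi(a,b)\in\{-1,0,1\}$ for all $a,b\in\mathcal U$, and $\mathcal R^{pc}=\{{\succ}\in\mathcal R: {\succ}\equiv\phi\text{ for some }\phi\in\Phi^{pc}\}$. Social welfare functions. $N=\{1,\dots,n\}$ with $n\ge2$ is the set of agents, $\mathcal D\subseteq\mathcal R$ a domain. A profile is $R=(\succ_1,\dots,\succ_n)\in\mathcal D^N$; restrictions $R|_X$ are componentwise. A social welfare function (SWF) is a map $f\colon\mathcal D^N\to\mathcal R$. It satisfies Pareto optimality if for all $p,q\in\Delta$, $R\in\mathcal D^N$ and ${\succ}=f(R)$: $p\succsim_iq$ for all $i\in N$ implies $p\succsim q$, and if additionally $p\succ_iq$ for some $i$ then $p\succ q$. It satisfies IIA if for all $R,\hat R\in\mathcal D^N$ and $X\subseteq\mathcal U$: $R|_{\Delta_X}=\hat R|_{\Delta_X}$ implies $f(R)|_{\Delta_X}=f(\hat R)|_{\Delta_X}$. It is Arrovian if it satisfies Pareto optimality and IIA. It is anonymous if $f(R)=f(R\circ\pi)$ for every $R\in\mathcal D^N$ and every permutation $\pi$ of $N$. Rich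 domains. For a permutation $\pi$ of $\mathcal U$ and $p\in\Delta$, $p^\pi(\pi(a))=p(a)$; ${\succ}^\pi$ is defined by $p^\pi\succ^\pi q^\pi\Leftrightarrow p\succ q$. ${\succ}^{-1}$ is defined by $p\succ^{-1}q\Leftrightarrow q\succ p$. $\mathcal D\subseteq\mathcal R$ is rich if: (R1) for all ${\succ}\in\mathcal R$ and all permutations $\pi$ of $\mathcal U$, ${\succ}\in\mathcal D$ if and only if ${\succ}^\pi\in\mathcal D$; (R2) $\emptyset\in\mathcal D$; (R3) ${\succ}\in\mathcal D$ implies ${\succ}^{-1}\in\mathcal D$; (R4) for all ${\hat\succ}\in\mathcal D$ and all $X\subsetneq\mathcal U$ with $|X|\le4$ there are ${\succ}\in\mathcal D$ and $a\in\mathcal U$ such that ${\succ}|_X={\hat\succ}|_X$ (restriction to the pure outcomes in $X$) and $x\succ a$ for all $x\in X$. *)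

theory Defs
  imports "HOL-Analysis.Analysis"
begin

text \<open>
  The alternatives are the elements of a finite type \<open>'a\<close>. An outcome is a vector in
  \<open>real ^ 'a\<close> lying in the simplex \<open>Delta\<close>, which carries the subspace topology; a
  preference relation is a set of pairs of elements of \<open>Delta\<close>, \<open>(p, q)\<close> meaning that
  \<open>p\<close> is strictly preferred to \<open>q\<close>.
\<close>

definition Delta :: "(real ^ 'a::finite) set" where
  "Delta = {p. (\<forall>a. 0 \<le> p $ a) \<and> (\<Sum>a\<in>UNIV. p $ a) = 1}"

definition Delta_on :: "'a::finite set \<Rightarrow> (real ^ 'a) set" where
  "Delta_on X = {p \<in> Delta. (\<Sum>a\<in>X. p $ a) = 1}"

definition pure :: "'a::finite \<Rightarrow> real ^ 'a" where
  "pure a = axis a 1"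

definition mix :: "real \<Rightarrow> real ^ 'a::finite \<Rightarrow> real ^ 'a \<Rightarrow> real ^ 'a" where
  "mix l p q = l *\<^sub>R p + (1 - l) *\<^sub>R q"

type_synonym 'a pref = "(real ^ 'a) rel"

definition indiff :: "'a::finite pref \<Rightarrow> real ^ 'a \<Rightarrow> real ^ 'a \<Rightarrow> bool" where
  "indiff S p q \<longleftrightarrow> (p, q) \<notin> S \<and> (q, p) \<notin> S"

definition weakly :: "'a::finite pref \<Rightarrow> real ^ 'a \<Rightarrow> real ^ 'a \<Rightarrow> bool" where
  "weakly S p q \<longleftrightarrow> (p, q) \<in> S \<or> indiff S p q"

definition upper :: "'a::finite pref \<Rightarrow> real ^ 'a \<Rightarrow> (real ^ 'a) set" where
  "upper S p = {q \<in> Delta. (q, p) \<in> S}"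

definition lower :: "'a::finite pref \<Rightarrow> real ^ 'a \<Rightarrow> (real ^ 'a) set" where
  "lower S p = {q \<in> Delta. (p, q) \<in> S}"

definition indiff_set :: "'a::finite pref \<Rightarrow> real ^ 'a \<Rightarrow> (real ^ 'a) set" where
  "indiff_set S p = {q \<in> Delta. indiff S p q}"

definition preference :: "'a::finite pref \<Rightarrow> bool" where
  "preference S \<longleftrightarrow> S \<subseteq> Delta \<times> Delta \<and> asym S"

definition pref_continuous :: "'a::finite pref \<Rightarrow> bool" where
  "pref_continuous S \<longleftrightarrow> (\<forall>p\<in>Delta.
     openin (top_of_set Delta) (upper S p) \<and> openin (top_of_set Delta) (lower S p))"

definition pref_convex :: "'a::finite pref \<Rightarrow> bool" where
  "pref_convex S \<longleftrightarrow> (\<forall>p\<in>Delta.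
     convex (upper S p) \<and> convex (lower S p) \<and>
     convex (upper S p \<union> indiff_set S p) \<and> convex (lower S p \<union> indiff_set S p))"

definition pref_symmetric :: "'a::finite pref \<Rightarrow> bool" where
  "pref_symmetric S \<longleftrightarrow> (\<forall>p\<in>Delta. \<forall>q\<in>Delta. \<forall>r\<in>Delta. \<forall>l\<in>{0<..<1}.
     indiff S q (mix (1/2) p r) \<longrightarrow>
     indiff S (mix l p r) (mix (1/2) p q) \<longrightarrow>
     indiff S (mix l r p) (mix (1/2) r q))"

definition prefs :: "'a::finite pref set" where
  "prefs = {S. preference S \<and> pref_continuous S \<and> pref_convex S \<and> pref_symmetric S}"

text \<open>
  SSB functions are maps on \<open>Delta \<times> Delta\<close>: all conditions below are relativised to
  \<open>Delta\<close>, and the values of the total function elsewhere are irrelevant.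
\<close>

definition ssb :: "(real ^ 'a::finite \<Rightarrow> real ^ 'a \<Rightarrow> real) \<Rightarrow> bool" where
  "ssb \<phi> \<longleftrightarrow>
     (\<forall>p\<in>Delta. \<forall>q\<in>Delta. \<phi> p q = - \<phi> q p) \<and>
     (\<forall>p\<in>Delta. \<forall>q\<in>Delta. \<forall>r\<in>Delta. \<forall>l\<in>{0..1}.
        \<phi> (mix l p q) r = l * \<phi> p r + (1 - l) * \<phi> q r \<and>
        \<phi> r (mix l p q) = l * \<phi> r p + (1 - l) * \<phi> r q)"

definition represents :: "(real ^ 'a::finite \<Rightarrow> real ^ 'a \<Rightarrow> real) \<Rightarrow> 'a pref \<Rightarrow> bool" where
  "represents \<phi> S \<longleftrightarrow> (\<forall>p\<in>Delta. \<forall>q\<in>Delta. (p, q) \<in> S \<longleftrightarrow> \<phi> p q > 0)"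

definition Phi :: "(real ^ 'a::finite \<Rightarrow> real ^ 'a \<Rightarrow> real) set" where
  "Phi = {\<phi>. ssb \<phi> \<and>
     ((\<exists>p\<in>Delta. \<exists>q\<in>Delta. \<phi> p q = 1) \<and> (\<forall>p\<in>Delta. \<forall>q\<in>Delta. \<phi> p q \<le> 1) \<or>
      (\<forall>p\<in>Delta. \<forall>q\<in>Delta. \<phi> p q = 0))}"

definition Phi_pc :: "(real ^ 'a::finite \<Rightarrow> real ^ 'a \<Rightarrow> real) set" where
  "Phi_pc = {\<phi> \<in> Phi. \<forall>a b. \<phi> (pure a) (pure b) \<in> {-1, 0, 1}}"

definition prefs_pc :: "'a::finite pref set" where
  "prefs_pc = {S \<in> prefs. \<exists>\<phi>\<in>Phi_pc. represents \<phi> S}"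

text \<open>
  Profiles for the agents \<open>{1..n}\<close> are extensional functions, so that two profiles
  are equal iff they agree on all agents.
\<close>

definition profiles :: "nat \<Rightarrow> 'a::finite pref set \<Rightarrow> (nat \<Rightarrow> 'a pref) set" where
  "profiles n D = {1..n} \<rightarrow>\<^sub>E D"

definition swf ::
  "nat \<Rightarrow> 'a::finite pref set \<Rightarrow> ((nat \<Rightarrow> 'a pref) \<Rightarrow> 'a pref) \<Rightarrow> bool" where
  "swf n D f \<longleftrightarrow> f \<in> profiles n D \<rightarrow> prefs"

definition pareto ::
  "nat \<Rightarrow> 'a::finite pref set \<Rightarrow> ((nat \<Rightarrow> 'a pref) \<Rightarrow> 'a pref) \<Rightarrow> bool" where
  "pareto n D f \<longleftrightarrow> (\<forall>p\<in>Delta. \<forall>q\<in>Delta. \<forall>R\<in>profiles n D.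
     (\<forall>i\<in>{1..n}. weakly (R i) p q) \<longrightarrow>
       weakly (f R) p q \<and> ((\<exists>i\<in>{1..n}. (p, q) \<in> R i) \<longrightarrow> (p, q) \<in> f R))"

definition iia ::
  "nat \<Rightarrow> 'a::finite pref set \<Rightarrow> ((nat \<Rightarrow> 'a pref) \<Rightarrow> 'a pref) \<Rightarrow> bool" where
  "iia n D f \<longleftrightarrow> (\<forall>R\<in>profiles n D. \<forall>R'\<in>profiles n D. \<forall>X.
     (\<forall>i\<in>{1..n}. Restr (R i) (Delta_on X) = Restr (R' i) (Delta_on X)) \<longrightarrow>
       Restr (f R) (Delta_on X) = Restr (f R') (Delta_on X))"

definition arrovian ::
  "nat \<Rightarrow> 'a::finite pref set \<Rightarrow> ((nat \<Rightarrow> 'a pref) \<Rightarrow> 'a pref) \<Rightarrow> bool" where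
  "arrovian n D f \<longleftrightarrow> pareto n D f \<and> iia n D f"

definition anonymous ::
  "nat \<Rightarrow> 'a::finite pref set \<Rightarrow> ((nat \<Rightarrow> 'a pref) \<Rightarrow> 'a pref) \<Rightarrow> bool" where
  "anonymous n D f \<longleftrightarrow>
     (\<forall>R\<in>profiles n D. \<forall>\<pi>. \<pi> permutes {1..n} \<longrightarrow> f R = f (R \<circ> \<pi>))"

text \<open>\<open>perm_outcome \<pi> p\<close> is the outcome assigning \<open>p $ a\<close> to \<open>\<pi> a\<close>, for bijective \<open>\<pi>\<close>.\<close>

definition perm_outcome :: "('a::finite \<Rightarrow> 'a) \<Rightarrow> real ^ 'a \<Rightarrow> real ^ 'a" where
  "perm_outcome \<pi> p = (\<chi> b. p $ (inv \<pi> b))"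

definition perm_pref :: "('a::finite \<Rightarrow> 'a) \<Rightarrow> 'a pref \<Rightarrow> 'a pref" where
  "perm_pref \<pi> S = {(perm_outcome \<pi> p, perm_outcome \<pi> q) | p q. (p, q) \<in> S}"

definition rich :: "'a::finite pref set \<Rightarrow> bool" where
  "rich D \<longleftrightarrow> D \<subseteq> prefs \<and>
     (\<forall>S\<in>prefs. \<forall>\<pi>. \<pi> permutes UNIV \<longrightarrow> (S \<in> D \<longleftrightarrow> perm_pref \<pi> S \<in> D)) \<and>
     {} \<in> D \<and>
     (\<forall>S\<in>D. S\<inverse> \<in> D) \<and>
     (\<forall>S'\<in>D. \<forall>X. X \<subset> UNIV \<and> card X \<le> 4 \<longrightarrow>
        (\<exists>S\<in>D. \<exists>a. Restr S (pure ` X) = Restr S' (pure ` X) \<and>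
           (\<forall>x\<in>X. (pure x, pure a) \<in> S)))"

end

theory Submission
  imports Defs
begin

text \<open>
  Fishburn's representation. The convexity and symmetry axioms make the comparison of two outcomes
  depend only on the oriented line through them and give strict dominance, so for an interior \<open>p\<close> the sets
  better and worse than \<open>p\<close> are the two sides of a hyperplane, the zero set of a functional \<open>v p\<close>. Along a chord
  these functionals, normalised on the direction of the chord, satisfy the midpoint identity by the
  symmetry axiom and are therefore affine. This yields the cocycle identity that allows
  the \<open>v p\<close> to be rescaled to a skew form.

  Aggregation. Let all agents but two be completely indifferent, so that by anonymity the social
  preference is a symmetric function of two preferences. If they rank two alternatives oppositely,
  society is indifferent. So two preferences that are opposite on all pairs from a set \<open>X\<close> make
  society indifferent on \<open>Delta_on X\<close>, and Pareto optimality forces their SSB matrices to be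
  proportional on \<open>X\<close>. Comparing a preference with permuted copies of itself or of its inverse then
  gives \<open>\<bar>\<phi>(a, b)\<bar> = \<bar>\<phi>(c, b)\<bar>\<close> unless \<open>a, b, c\<close> is a transitive triple with \<open>b\<close> at an end; there the
  comparison is with a chain of four alternatives provided by richness, which has equal entries by the
  other cases.
\<close>

section \<open>Preferences along lines\<close>

text \<open>Separation at \<open>p\<close> needs outcomes strictly better and strictly worse than
  \<open>p\<close>, and a point on the boundary of \<open>Delta\<close> may lack one kind. Hence
  functionals are built at interior points, glued to one skew linear map on a spanning set of such
  points, and carried to the boundary by limits; strictness and indifference survive the limit only
  through an extra argument at a midpoint.

  The aggregation plays sizes against signs. For two alternatives IIA sees only the sign of a matrix
  entry. But if society is indifferent on all of \<open>Delta_on X\<close>, every zero of one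
  bilinear form is a zero of the other, and zeros fix the ratios of entries. To compare
  \<open>M a b\<close> with \<open>M c b\<close>, the natural opponent is the preference with
  \<open>a\<close> and \<open>c\<close> swapped, or its inverse. The swap always negates
  \<open>M a c\<close>, so neither opponent is opposite on all three pairs when \<open>a\<close> and
  \<open>c\<close> are strictly ranked and \<open>b\<close> is at an end; a further alternative has
  to mediate there.\<close>

lemma mix_in_Delta: "p \<in> Delta \<Longrightarrow> q \<in> Delta \<Longrightarrow> 0 \<le> l \<Longrightarrow> l \<le> 1 \<Longrightarrow> mix l p q \<in> Delta"
  unfolding Delta_def mix_def
  by (auto simp: sum.distrib simp flip: sum_distrib_left)

lemma mix_swap: "mix l p q = mix (1 - l) q p"
  by (simp add: mix_def add.commute)

lemma convex_mix: "convex C \<Longrightarrow> p \<in> C \<Longrightarrow> q \<in> C \<Longrightarrow> 0 \<le> l \<Longrightarrow> l \<le> 1 \<Longrightarrow> mix l p q \<in> C"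
  unfolding mix_def by (rule convexD) auto

text \<open>Lets indifference on a small fraction of a segment, doubled repeatedly, reach the far
  end. The \<open>min 1\<close> in the induction caters for the last doubling, which may
  overshoot.\<close>

lemma doubling:
  fixes P :: "real \<Rightarrow> bool"
  assumes down: "\<And>s t. P t \<Longrightarrow> 0 \<le> s \<Longrightarrow> s \<le> t \<Longrightarrow> t \<le> 1 \<Longrightarrow> P s"
    and dbl: "\<And>t. P t \<Longrightarrow> 0 < t \<Longrightarrow> t \<le> 1/2 \<Longrightarrow> P (2 * t)"
    and t0: "P w" "0 < w" "w \<le> 1"
  shows "P 1"
proof -
  have "P (min 1 (2 ^ k * w))" for k
  proof (induction k)
    case 0
    then show ?case using t0 by simp
  next
    case (Suc k)
    define u where "u = 2 ^ k * w"
    have "u > 0" using t0 by (simp add: u_def)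
    show ?case
    proof (cases "u \<le> 1/2")
      case True
      then have "P (2 * u)" using Suc dbl[of u] \<open>u > 0\<close> by (simp add: u_def min_absorb2)
      then show ?thesis using True by (simp add: u_def min_absorb2 mult.assoc)
    next
      case False
      then have "P (1/2)" using down[OF Suc, of "1/2"] by (simp add: u_def)
      then have "P 1" using dbl[of "1/2"] by simp
      then show ?thesis using False by (simp add: u_def min_def mult.assoc)
    qed
  qed
  moreover obtain k where "1 / w < 2 ^ k"
    using real_arch_pow[of 2 "1/w"] by auto
  then have "1 \<le> 2 ^ k * w" using t0 by (simp add: field_simps)
  ultimately show ?thesis by (metis min.absorb1)
qed

lemma indiff_sym: "indiff S p q \<longleftrightarrow> indiff S q p"
  by (auto simp: indiff_def)

lemma indiff_converse: "indiff (S\<inverse>) p q \<longleftrightarrow> indiff S p q"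
  by (auto simp: indiff_def)

lemma prefs_converse: "S \<in> prefs \<Longrightarrow> S\<inverse> \<in> prefs"
proof -
  have u: "upper (S\<inverse>) p = lower S p" for p by (auto simp: upper_def lower_def)
  have l: "lower (S\<inverse>) p = upper S p" for p by (auto simp: upper_def lower_def)
  have i: "indiff_set (S\<inverse>) p = indiff_set S p" for p by (auto simp: indiff_set_def indiff_def)
  assume "S \<in> prefs"
  then show ?thesis
    unfolding prefs_def preference_def pref_continuous_def pref_convex_def pref_symmetric_def
    by (auto simp: asym_on_def u l i indiff_converse)
qed

locale convex_pref =
  fixes S :: "'a::finite pref"
  assumes S: "S \<in> prefs"
begin

lemma dual: "convex_pref (S\<inverse>)"
  using S prefs_converse by (auto simp: convex_pref_def)

lemma in_Delta: "(p, q) \<in> S \<Longrightarrow> p \<in> Delta" "(p, q) \<in> S \<Longrightarrow> q \<in> Delta"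
  using S by (auto simp: prefs_def preference_def)

lemma not_sym: "(p, q) \<in> S \<Longrightarrow> (q, p) \<notin> S"
  using S by (auto simp: prefs_def preference_def asym_on_def)

lemma indiff_refl: "indiff S p p"
  using not_sym by (auto simp: indiff_def)

lemma trichotomy: "(p, q) \<in> S \<or> (q, p) \<in> S \<or> indiff S p q"
  by (auto simp: indiff_def)

text \<open>By asymmetry, the union of the lower set and the indifference set is the complement of
  the upper set in \<open>Delta\<close>.\<close>

lemma lower_weak_mix:
  assumes "p \<in> Delta" "q \<in> Delta" "r \<in> Delta" "(q, p) \<notin> S" "(r, p) \<notin> S" "0 \<le> l" "l \<le> 1"
  shows "(mix l q r, p) \<notin> S"
proof -
  have "convex (lower S p \<union> indiff_set S p)"
    using S assms by (auto simp: prefs_def pref_convex_def)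
  moreover have "lower S p \<union> indiff_set S p = {q \<in> Delta. (q, p) \<notin> S}"
    using not_sym by (auto simp: lower_def indiff_set_def indiff_def)
  ultimately show ?thesis using assms convex_mix by fastforce
qed

lemma upper_weak_mix:
  assumes "p \<in> Delta" "q \<in> Delta" "r \<in> Delta" "(p, q) \<notin> S" "(p, r) \<notin> S" "0 \<le> l" "l \<le> 1"
  shows "(p, mix l q r) \<notin> S"
  using convex_pref.lower_weak_mix[OF dual, of p q r l] assms by auto

lemma indiff_mix:
  assumes "p \<in> Delta" "q \<in> Delta" "r \<in> Delta" "indiff S p q" "indiff S p r" "0 \<le> l" "l \<le> 1"
  shows "indiff S p (mix l q r)"
  using upper_weak_mix[of p q r l] lower_weak_mix[of p q r l] assms by (auto simp: indiff_def)

lemma symmetry: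
  assumes "p \<in> Delta" "q \<in> Delta" "r \<in> Delta" "0 < l" "l < 1"
    "indiff S q (mix (1/2) p r)" "indiff S (mix l p r) (mix (1/2) p q)"
  shows "indiff S (mix l r p) (mix (1/2) r q)"
  using S assms by (auto simp: prefs_def pref_symmetric_def)

lemma open_lower:
  assumes "(p, q) \<in> S"
  shows "\<exists>e>0. \<forall>z\<in>Delta. dist z q < e \<longrightarrow> (p, z) \<in> S"
proof -
  have "openin (top_of_set Delta) (lower S p)"
    using S assms in_Delta by (auto simp: prefs_def pref_continuous_def)
  moreover have "q \<in> lower S p" using assms in_Delta by (auto simp: lower_def)
  ultimately obtain e where "e > 0" "ball q e \<inter> Delta \<subseteq> lower S p"
    unfolding openin_contains_ball by auto
  then show ?thesis by (intro exI[of _ e]) (force simp: lower_def dist_commute)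
qed

lemma open_upper:
  assumes "(q, p) \<in> S"
  shows "\<exists>e>0. \<forall>z\<in>Delta. dist z q < e \<longrightarrow> (z, p) \<in> S"
  using convex_pref.open_lower[OF dual, of p q] assms by auto

lemma dist_mix: "dist (mix t z q) q = \<bar>t\<bar> * norm (z - q)"
proof -
  have "mix t z q - q = t *\<^sub>R (z - q)" by (simp add: mix_def algebra_simps)
  then show ?thesis by (simp add: dist_norm)
qed

lemma small_mix:
  assumes "e > 0"
  shows "\<exists>d>0. d \<le> 1 \<and> (\<forall>t. 0 \<le> t \<longrightarrow> t < d \<longrightarrow> dist (mix t z q) q < e)"
proof -
  define d where "d = min 1 (e / (norm (z - q) + 1))"
  have n: "norm (z - q) + 1 > 0" by (simp add: add_nonneg_pos)
  have "d > 0" using assms n by (simp add: d_def)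
  moreover have "dist (mix t z q) q < e" if "0 \<le> t" "t < d" for t
  proof -
    have "t * (norm (z - q) + 1) < e" using that n by (simp add: d_def field_simps)
    then show ?thesis using that by (simp add: dist_mix algebra_simps)
  qed
  ultimately show ?thesis by (intro exI[of _ d]) (auto simp: d_def)
qed

lemma open_lower_mix:
  assumes "(p, q) \<in> S" "z \<in> Delta"
  shows "\<exists>d>0. d \<le> 1 \<and> (\<forall>t. 0 \<le> t \<longrightarrow> t < d \<longrightarrow> (p, mix t z q) \<in> S)"
proof -
  obtain e where e: "e > 0" "\<And>y. y \<in> Delta \<Longrightarrow> dist y q < e \<Longrightarrow> (p, y) \<in> S"
    using open_lower[OF assms(1)] by blast
  obtain d where d: "d > 0" "d \<le> 1" "\<And>t. 0 \<le> t \<Longrightarrow> t < d \<Longrightarrow> dist (mix t z q) q < e"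
    using small_mix[OF e(1), of z q] by blast
  have "(p, mix t z q) \<in> S" if "0 \<le> t" "t < d" for t
    using e(2) d that assms in_Delta[OF assms(1)] by (intro e(2)) (auto intro!: mix_in_Delta)
  then show ?thesis using d by blast
qed

lemma open_upper_mix:
  assumes "(q, p) \<in> S" "z \<in> Delta"
  shows "\<exists>d>0. d \<le> 1 \<and> (\<forall>t. 0 \<le> t \<longrightarrow> t < d \<longrightarrow> (mix t z q, p) \<in> S)"
  using convex_pref.open_lower_mix[OF dual, of p q z] assms by auto

text \<open>The symmetry axiom with \<open>r\<close> itself as the middle outcome makes
  \<open>r\<close> indifferent to points arbitrarily close to \<open>p\<close>, which openness of
  strict preference excludes unless \<open>r\<close> and \<open>p\<close> are indifferent.\<close>

lemma indiff_midpoint_end: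
  assumes "p \<in> Delta" "r \<in> Delta" "indiff S r (mix (1/2) p r)"
  shows "indiff S r p"
proof (rule ccontr)
  assume "\<not> indiff S r p"
  then have "(r, p) \<in> S \<or> (p, r) \<in> S" by (auto simp: indiff_def)
  then obtain d where d: "d > 0" "d \<le> 1"
      "\<And>t. 0 \<le> t \<Longrightarrow> t < d \<Longrightarrow> (r, mix t r p) \<in> S \<or> (mix t r p, r) \<in> S"
    using open_lower_mix[of r p r] open_upper_mix[of p r r] assms by meson
  define l where "l = d / 2"
  let ?m = "mix (1/2) p r"
  have "?m \<in> Delta" using assms by (auto intro: mix_in_Delta)
  then have "indiff S ?m (mix (2 * l) ?m r)"
    using assms d indiff_refl[of ?m] indiff_sym[of S r ?m]
    by (intro indiff_mix[of ?m ?m r]) (auto simp: l_def)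
  moreover have "mix (2 * l) ?m r = mix l p r" by (simp add: vec_eq_iff mix_def field_simps)
  ultimately have "indiff S (mix l p r) ?m" by (simp add: indiff_sym)
  then have "indiff S (mix l r p) (mix (1/2) r r)"
    using symmetry[OF assms(1,2,2) _ _ assms(3), of l] d by (simp add: l_def)
  moreover have "mix (1/2) r r = r" by (simp add: vec_eq_iff mix_def field_simps)
  ultimately show False using d(3)[of l] d by (auto simp: l_def indiff_def)
qed

lemma indiff_part_end:
  assumes "p \<in> Delta" "r \<in> Delta" "indiff S r (mix t p r)" "0 < t" "t \<le> 1"
  shows "indiff S r p"
proof -
  have "indiff S r (mix 1 p r)"
  proof (rule doubling[where w = t])
    fix s u :: real
    assume a: "indiff S r (mix u p r)" "0 \<le> s" "s \<le> u" "u \<le> 1"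
    show "indiff S r (mix s p r)"
    proof (cases "u = 0")
      case True
      then show ?thesis using a by simp
    next
      case False
      have "indiff S r (mix (s / u) (mix u p r) r)"
        using a assms False
        by (intro indiff_mix[of r "mix u p r" r] mix_in_Delta) (auto simp: indiff_refl)
      moreover have "mix (s / u) (mix u p r) r = mix s p r"
        using False by (simp add: vec_eq_iff mix_def field_simps)
      ultimately show ?thesis by simp
    qed
  next
    fix u :: real
    assume a: "indiff S r (mix u p r)" "0 < u" "u \<le> 1/2"
    have "mix (1/2) (mix (2 * u) p r) r = mix u p r"
      by (simp add: vec_eq_iff mix_def field_simps)
    then show "indiff S r (mix (2 * u) p r)"
      using a assms indiff_midpoint_end[of "mix (2 * u) p r" r] by (simp add: mix_in_Delta)
  qed (use assms in auto)
  then show ?thesis by (simp add: mix_def)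
qed

text \<open>Convexity gives only weak preference; indifference at an inner point would spread to the
  end \<open>p\<close>.\<close>

lemma strict_part:
  assumes "(r, p) \<in> S" "0 < t" "t \<le> 1"
  shows "(r, mix t p r) \<in> S"
proof -
  have D: "p \<in> Delta" "r \<in> Delta" using in_Delta assms by auto
  have "\<not> indiff S r (mix t p r)"
    using indiff_part_end[OF D] assms by (auto simp: indiff_def)
  moreover have "(mix t p r, r) \<notin> S"
    using D assms not_sym by (intro lower_weak_mix) auto
  ultimately show ?thesis by (auto simp: indiff_def)
qed

lemma strict_part': "(p, r) \<in> S \<Longrightarrow> 0 < t \<Longrightarrow> t \<le> 1 \<Longrightarrow> (mix t p r, r) \<in> S"
  using convex_pref.strict_part[OF dual, of r p t] by auto

lemma indiff_part: "p \<in> Delta \<Longrightarrow> r \<in> Delta \<Longrightarrow> indiff S r p \<Longrightarrow> 0 \<le> t \<Longrightarrow> t \<le> 1 \<Longrightarrow> indiff S r (mix t p r)"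
  by (intro indiff_mix) (auto simp: indiff_refl)

lemma strict_segment:
  assumes "(p, q) \<in> S" "0 \<le> s" "s < t" "t \<le> 1"
  shows "(mix s q p, mix t q p) \<in> S"
proof -
  have "(p, mix t q p) \<in> S" using strict_part assms by simp
  then have "(mix ((t - s) / t) p (mix t q p), mix t q p) \<in> S"
    using assms by (intro strict_part') auto
  moreover have "mix ((t - s) / t) p (mix t q p) = mix s q p"
    using assms by (simp add: vec_eq_iff mix_def field_simps)
  ultimately show ?thesis by simp
qed

lemma indiff_segment:
  assumes "p \<in> Delta" "q \<in> Delta" "indiff S p q" "0 \<le> s" "s \<le> t" "t \<le> 1"
  shows "indiff S (mix s q p) (mix t q p)"
proof (cases "t = 0")
  case True
  then show ?thesis using assms indiff_refl by auto
next
  case False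
  have "indiff S p (mix t q p)" using indiff_part assms by simp
  then have "indiff S (mix t q p) (mix ((t - s) / t) p (mix t q p))"
    using assms False by (intro indiff_part mix_in_Delta) (auto simp: indiff_sym)
  moreover have "mix ((t - s) / t) p (mix t q p) = mix s q p"
    using assms False by (simp add: vec_eq_iff mix_def field_simps)
  ultimately show ?thesis by (simp add: indiff_sym)
qed

text \<open>The reflection of the line \<open>p r\<close> in the line through \<open>p\<close> and the midpoint of \<open>q r\<close> is
  the line \<open>p q\<close>; the symmetry axiom yields it only in the limit \<open>b \<rightarrow> 0\<close>.\<close>

lemma indiff_reflect:
  assumes D: "p \<in> Delta" "q \<in> Delta" "r \<in> Delta"
    and "indiff S p r" "indiff S p (mix (1/2) q r)"
  shows "indiff S p q"
proof (rule ccontr)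
  assume "\<not> indiff S p q"
  then have "(p, q) \<in> S \<or> (q, p) \<in> S" by (auto simp: indiff_def)
  then obtain d where d: "d > 0" "d \<le> 1"
      "\<And>t. 0 \<le> t \<Longrightarrow> t < d \<Longrightarrow> (p, mix t r q) \<in> S \<or> (mix t r q, p) \<in> S"
    using open_lower_mix[of p q r] open_upper_mix[of q p r] assms by meson
  \<comment> \<open>\<open>Q\<close> below lies slightly off \<open>p\<close> towards the midpoint
    of \<open>q\<close> and \<open>r\<close>. The value of \<open>l\<close> is forced: the ray from
    \<open>p\<close> through the midpoint of \<open>r\<close> and \<open>Q\<close> meets the segment
    \<open>q r\<close> at \<open>mix l r q\<close>. Since \<open>1 - l = b * e / 2\<close>, the
    mirror point \<open>mix l q r\<close> is close to \<open>q\<close>.\<close>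
  define b where "b = d / 2"
  define e where "e = 1 / (1 + b)"
  define l where "l = (1 + e) / 2"
  have b: "0 < b" "b < 1" "b < d" using d by (auto simp: b_def)
  have e: "0 < e" "e < 1" "e * (1 + b) = 1" using b by (auto simp: e_def)
  have l: "0 < l" "l < 1" using e by (auto simp: l_def)
  have "1 - l = b * e / 2" using e by (simp add: l_def field_simps)
  also have "\<dots> < d" using b e mult_strict_left_mono[of e 1 b] by linarith
  finally have ld: "1 - l < d" .
  let ?m = "mix (1/2) q r"
  define Q where "Q = mix b ?m p"
  have mD: "?m \<in> Delta" using D by (auto intro: mix_in_Delta)
  have QD: "Q \<in> Delta" unfolding Q_def using D mD b by (auto intro!: mix_in_Delta)
  have eb: "e + b * e = 1" using e(3) by (simp add: algebra_simps)
  have half: "mix (1/2) x Q = mix ((1 + b) / 2) (mix l x y) p"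
    if "x = q \<and> y = r \<or> x = r \<and> y = q" for x y
  proof -
    have "(1 + b) * l = (2 + b) / 2" "(1 + b) * (1 - l) = b / 2"
      using eb by (auto simp: l_def field_simps)
    then have f1: "(1 + b) * (l * x $ i + (1 - l) * y $ i) = (2 + b) / 2 * x $ i + b / 2 * y $ i" for i
      by (metis (no_types, lifting) distrib_left mult.assoc)
    have f2: "mix (1/2) x Q $ i = ((2 + b) / 2 * x $ i + b / 2 * y $ i + (1 - b) * p $ i) / 2" for i
      using that by (auto simp: Q_def mix_def field_simps)
    have f3: "mix ((1 + b) / 2) (mix l x y) p $ i
        = ((1 + b) * (l * x $ i + (1 - l) * y $ i) + (1 - b) * p $ i) / 2" for i
      by (simp add: mix_def field_simps)
    show ?thesis by (simp add: vec_eq_iff f1 f2 f3)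
  qed
  have 1: "indiff S Q (mix (1/2) r q)"
  proof -
    have "indiff S (mix b ?m p) (mix 1 ?m p)" using D mD assms b by (intro indiff_segment) auto
    moreover have "mix 1 ?m p = mix (1/2) r q" by (simp add: mix_def add.commute)
    ultimately show ?thesis by (simp add: Q_def)
  qed
  have X: "indiff S p (mix l r q)"
  proof -
    have "indiff S p (mix e r ?m)" using D mD assms e by (intro indiff_mix[of p r ?m]) auto
    moreover have "mix e r ?m = mix l r q" by (simp add: vec_eq_iff mix_def l_def field_simps)
    ultimately show ?thesis by simp
  qed
  have XD: "mix l r q \<in> Delta" "mix l q r \<in> Delta" using D l by (auto intro!: mix_in_Delta)
  have "indiff S (mix ((1 + b) / 2) (mix l r q) p) (mix 1 (mix l r q) p)"
    using D XD X b by (intro indiff_segment) auto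
  then have 2: "indiff S (mix l r q) (mix (1/2) r Q)"
    using half[of r q] by (simp add: mix_def[of 1] indiff_sym)
  \<comment> \<open>Symmetry with ends \<open>r\<close>, \<open>q\<close> and middle outcome
    \<open>Q\<close> carries indifference from the line through \<open>p\<close> and
    \<open>mix l r q\<close> to the line through \<open>p\<close> and
    \<open>mix l q r\<close>.\<close>
  have "indiff S (mix l q r) (mix (1/2) q Q)"
    using symmetry[OF D(3) QD D(2) l 1 2] by simp
  moreover have b2: "1 - (1 + b) / 2 = (1 - b) / 2" by (simp add: field_simps)
  ultimately have "indiff S (mix l q r) (mix ((1 - b) / 2) p (mix l q r))"
    using half[of q r] mix_swap[of "(1 + b) / 2" "mix l q r" p] b2 by simp
  then have "indiff S (mix l q r) p"
    using D XD b indiff_part_end[of p "mix l q r" "(1 - b) / 2"] by simp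
  moreover have "mix l q r = mix (1 - l) r q" by (rule mix_swap)
  ultimately show False using d(3)[of "1 - l"] ld l by (auto simp: indiff_def)
qed

lemma indiff_extend:
  assumes "p \<in> Delta" "q \<in> Delta" "r \<in> Delta" "indiff S p r" "indiff S p (mix t q r)" "0 < t" "t \<le> 1"
  shows "indiff S p q"
proof -
  have "indiff S p (mix 1 q r)"
  proof (rule doubling[where w = t])
    fix s u :: real
    assume a: "indiff S p (mix u q r)" "0 \<le> s" "s \<le> u" "u \<le> 1"
    show "indiff S p (mix s q r)"
    proof (cases "u = 0")
      case True
      then show ?thesis using a by simp
    next
      case False
      have "indiff S p (mix (s / u) (mix u q r) r)"
        using a assms False
        by (intro indiff_mix[of p "mix u q r" r] mix_in_Delta) auto
      moreover have "mix (s / u) (mix u q r) r = mix s q r"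
        using False by (simp add: vec_eq_iff mix_def field_simps)
      ultimately show ?thesis by simp
    qed
  next
    fix u :: real
    assume a: "indiff S p (mix u q r)" "0 < u" "u \<le> 1/2"
    have "mix (1/2) (mix (2 * u) q r) r = mix u q r"
      by (simp add: vec_eq_iff mix_def field_simps)
    then show "indiff S p (mix (2 * u) q r)"
      using a assms indiff_reflect[of p "mix (2 * u) q r" r] by (simp add: mix_in_Delta)
  qed (use assms in auto)
  then show ?thesis by (simp add: mix_def)
qed

text \<open>Weak preference is convexity again; indifference at \<open>mix t q r\<close> would
  extend from \<open>r\<close> along the segment to \<open>q\<close>.\<close>

lemma dominance:
  assumes "(p, q) \<in> S" "r \<in> Delta" "indiff S p r" "0 < t" "t \<le> 1"
  shows "(p, mix t q r) \<in> S"
proof -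
  have D: "p \<in> Delta" "q \<in> Delta" using in_Delta assms by auto
  have "\<not> indiff S p (mix t q r)"
    using indiff_extend[OF D assms(2,3) _ assms(4,5)] assms(1) by (auto simp: indiff_def)
  moreover have "(mix t q r, p) \<notin> S"
    using D assms not_sym by (intro lower_weak_mix) (auto simp: indiff_def)
  ultimately show ?thesis by (auto simp: indiff_def)
qed

lemma dominance': "(q, p) \<in> S \<Longrightarrow> r \<in> Delta \<Longrightarrow> indiff S p r \<Longrightarrow> 0 < t \<Longrightarrow> t \<le> 1 \<Longrightarrow> (mix t q r, p) \<in> S"
  using convex_pref.dominance[OF dual, of p q r t] indiff_converse by auto

end

section \<open>Supporting functionals\<close>

lemma sum_Delta: "p \<in> Delta \<Longrightarrow> (\<Sum>a\<in>UNIV. p $ a) = 1"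
  by (simp add: Delta_def)

lemma inner_mix: "v \<bullet> mix t p q = t * (v \<bullet> p) + (1 - t) * (v \<bullet> q)"
  by (simp add: mix_def inner_add_right)

lemma pure_Delta: "pure a \<in> Delta"
  by (auto simp: Delta_def pure_def axis_def)

lemma inner_pure: "v \<bullet> pure a = v $ a"
  by (simp add: pure_def inner_axis)

definition Delta_pos :: "(real ^ 'a::finite) set" where
  "Delta_pos = {p \<in> Delta. \<forall>a. 0 < p $ a}"

lemma Delta_pos_Delta: "p \<in> Delta_pos \<Longrightarrow> p \<in> Delta"
  by (simp add: Delta_pos_def)

lemma mix_Delta_pos:
  assumes "p \<in> Delta_pos" "q \<in> Delta" "0 < l" "l \<le> 1"
  shows "mix l p q \<in> Delta_pos"
proof -
  have "0 < l * p $ a + (1 - l) * q $ a" for a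
    using assms by (intro add_pos_nonneg) (auto simp: Delta_pos_def Delta_def)
  then show ?thesis
    using assms mix_in_Delta[of p q l] by (auto simp: Delta_pos_def mix_def)
qed

lemma mix_Delta_pos':
  assumes "p \<in> Delta_pos" "q \<in> Delta_pos" "0 \<le> l" "l \<le> 1"
  shows "mix l p q \<in> Delta_pos"
proof (cases "l = 0")
  case True
  then show ?thesis using assms by (simp add: mix_def)
next
  case False
  then show ?thesis using assms mix_Delta_pos Delta_pos_Delta by force
qed

lemma Delta_pos_perturb:
  assumes "p \<in> Delta_pos" "(\<Sum>a\<in>UNIV. d $ a) = 0"
  shows "\<exists>e>0. \<forall>s. \<bar>s\<bar> < e \<longrightarrow> p + s *\<^sub>R d \<in> Delta"
proof -
  define e where "e = Min (range (\<lambda>a. p $ a / (\<bar>d $ a\<bar> + 1)))"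
  have pos: "p $ a > 0" for a using assms by (auto simp: Delta_pos_def)
  have "e > 0" unfolding e_def using pos by (subst Min_gr_iff) (auto intro!: divide_pos_pos)
  moreover have "p + s *\<^sub>R d \<in> Delta" if "\<bar>s\<bar> < e" for s
  proof -
    have "0 \<le> p $ a + s * d $ a" for a
    proof -
      have "\<bar>s\<bar> \<le> p $ a / (\<bar>d $ a\<bar> + 1)" using that unfolding e_def by (auto simp: less_imp_le)
      then have "\<bar>s\<bar> * (\<bar>d $ a\<bar> + 1) \<le> p $ a" by (subst (asm) pos_le_divide_eq) auto
      then have "\<bar>s * d $ a\<bar> \<le> p $ a" by (simp add: abs_mult algebra_simps)
      then show ?thesis by linarith
    qed
    then show ?thesis
      using assms by (simp add: Delta_pos_def Delta_def sum.distrib flip: sum_distrib_left)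
  qed
  ultimately show ?thesis by blast
qed

lemma Delta_pos_nonempty: "\<exists>b. b \<in> (Delta_pos :: (real ^ 'a::finite) set)"
proof -
  have "(\<chi> i. 1 / real CARD('a)) \<in> (Delta_pos :: (real ^ 'a) set)"
    by (simp add: Delta_pos_def Delta_def)
  then show ?thesis by blast
qed

text \<open>The identity is assumed only with twice the step to spare on both sides, because the
  symmetry axiom will be used on points about \<open>2 * e\<close> away. Half the distance to the
  nearer end is an admissible step, and at the leftmost maximum the identity produces a maximum
  further left.\<close>

lemma midpoint_max_principle:
  fixes g :: "real \<Rightarrow> real"
  assumes c: "continuous_on {0..1} g" and g: "g 0 = 0" "g 1 = 0"
    and mid: "\<And>t e. 0 < e \<Longrightarrow> 0 \<le> t - 2 * e \<Longrightarrow> t + 2 * e \<le> 1 \<Longrightarrow> g (t - e) + g (t + e) = 2 * g t"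
    and t: "t \<in> {0..1}"
  shows "g t \<le> 0"
proof (rule ccontr)
  assume "\<not> g t \<le> 0"
  obtain m where m: "m \<in> {0..1}" "\<And>s. s \<in> {0..1} \<Longrightarrow> g s \<le> g m"
    using continuous_attains_sup[OF _ _ c] by force
  let ?K = "{s \<in> {0..1}. g s = g m}"
  have "closed ?K" using c by (intro continuous_closed_preimage_constant) auto
  then have "compact ({0..1} \<inter> ?K)" by (intro compact_Int_closed) auto
  moreover have "{0..1} \<inter> ?K = ?K" by blast
  ultimately have "compact ?K" by simp
  moreover have "?K \<noteq> {}" using m by blast
  ultimately obtain x where x: "x \<in> ?K" "\<And>s. s \<in> ?K \<Longrightarrow> x \<le> s"
    using compact_attains_inf[of ?K] by blast
  have "g m > 0" using m(2)[OF t] \<open>\<not> g t \<le> 0\<close> by simp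
  have gx: "g x = g m" "0 \<le> x" "x \<le> 1" using x(1) by auto
  have "x \<noteq> 0" "x \<noteq> 1" using \<open>g m > 0\<close> gx(1) g by (metis less_irrefl)+
  then have x01: "0 < x" "x < 1" using gx by simp_all
  define e where "e = min x (1 - x) / 2"
  have e: "0 < e" "0 \<le> x - 2 * e" "x + 2 * e \<le> 1" using x01 by (auto simp: e_def)
  have "g (x - e) + g (x + e) = 2 * g m" using mid[OF e] gx(1) by simp
  moreover have "g (x - e) \<le> g m" "g (x + e) \<le> g m" using e x01 by (auto intro!: m(2))
  ultimately have "g (x - e) = g m" by simp
  then have "x - e \<in> ?K" using e x01 by simp
  from x(2)[OF this] show False using e by simp
qed

lemma midpoint_affine:
  fixes h :: "real \<Rightarrow> real"
  assumes c: "continuous_on {0..1} h"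
    and mid: "\<And>t e. 0 < e \<Longrightarrow> 0 \<le> t - 2 * e \<Longrightarrow> t + 2 * e \<le> 1 \<Longrightarrow> h (t - e) + h (t + e) = 2 * h t"
    and t: "t \<in> {0..1}"
  shows "h t = (1 - t) * h 0 + t * h 1"
proof -
  have "h t - ((1 - t) * h 0 + t * h 1) \<le> 0"
  proof (rule midpoint_max_principle[of "\<lambda>t. h t - ((1 - t) * h 0 + t * h 1)"])
    fix s e :: real
    assume "0 < e" "0 \<le> s - 2 * e" "s + 2 * e \<le> 1"
    from mid[OF this]
    show "h (s - e) - ((1 - (s - e)) * h 0 + (s - e) * h 1) +
          (h (s + e) - ((1 - (s + e)) * h 0 + (s + e) * h 1)) =
          2 * (h s - ((1 - s) * h 0 + s * h 1))"
      by (simp add: algebra_simps)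
  qed (use c t in \<open>auto intro!: continuous_intros\<close>)
  moreover have "- (h t - ((1 - t) * h 0 + t * h 1)) \<le> 0"
  proof (rule midpoint_max_principle[of "\<lambda>t. - (h t - ((1 - t) * h 0 + t * h 1))"])
    fix s e :: real
    assume "0 < e" "0 \<le> s - 2 * e" "s + 2 * e \<le> 1"
    from mid[OF this]
    show "- (h (s - e) - ((1 - (s - e)) * h 0 + (s - e) * h 1)) +
          - (h (s + e) - ((1 - (s + e)) * h 0 + (s + e) * h 1)) =
          2 * - (h s - ((1 - s) * h 0 + s * h 1))"
      by (simp add: algebra_simps)
  qed (use c t in \<open>auto intro!: continuous_intros\<close>)
  ultimately show ?thesis by simp
qed

section \<open>Separating the outcomes better and worse than a given one\<close>

context convex_pref
begin

text \<open>\<open>v\<close> plays the role of the row at \<open>p\<close> of an SSB function, known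
  up to a positive factor. A homogeneous functional suffices because outcomes have coordinate sum
  one, so a constant term can be absorbed.\<close>

definition functional_at :: "real ^ 'a \<Rightarrow> real ^ 'a \<Rightarrow> bool" where
  "functional_at v p \<longleftrightarrow>
     (\<forall>q\<in>Delta. ((p, q) \<in> S \<longleftrightarrow> 0 < v \<bullet> q) \<and> ((q, p) \<in> S \<longleftrightarrow> v \<bullet> q < 0))"

lemma functional_at_indiff: "functional_at v p \<Longrightarrow> q \<in> Delta \<Longrightarrow> indiff S p q \<longleftrightarrow> v \<bullet> q = 0"
  unfolding functional_at_def indiff_def by (metis linorder_neqE_linordered_idom less_irrefl)

lemma functional_at_self: "functional_at v p \<Longrightarrow> p \<in> Delta \<Longrightarrow> v \<bullet> p = 0"
  using functional_at_indiff indiff_refl by blast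

lemma functional_at_scale:
  assumes "functional_at v p" "c > 0"
  shows "functional_at (c *\<^sub>R v) p"
  using assms by (auto simp: functional_at_def zero_less_mult_iff mult_less_0_iff)

text \<open>If \<open>v\<close> vanished at \<open>a\<close>, openness around \<open>a\<close> would
  make \<open>v\<close> nonnegative on \<open>Delta\<close>, hence zero at \<open>b\<close>;
  openness around \<open>b\<close> would make it nonpositive as well, and a functional vanishing at
  all pure outcomes is \<open>0\<close>.\<close>

lemma separation_strict:
  assumes v: "v \<noteq> 0" and lo: "\<And>a. (p, a) \<in> S \<Longrightarrow> 0 \<le> v \<bullet> a"
    and up: "\<And>b. (b, p) \<in> S \<Longrightarrow> v \<bullet> b \<le> 0"
    and a: "(p, a) \<in> S" and b: "(b, p) \<in> S"
  shows "0 < v \<bullet> a"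
proof (rule ccontr)
  assume "\<not> 0 < v \<bullet> a"
  then have a0: "v \<bullet> a = 0" using lo[OF a] by simp
  have ge: "0 \<le> v \<bullet> z" if "z \<in> Delta" for z
  proof -
    obtain d where "d > 0" "d \<le> 1" "\<And>t. 0 \<le> t \<Longrightarrow> t < d \<Longrightarrow> (p, mix t z a) \<in> S"
      using open_lower_mix[OF a \<open>z \<in> Delta\<close>] by blast
    then have "(p, mix (d / 2) z a) \<in> S" by simp
    from lo[OF this] show ?thesis using a0 \<open>d > 0\<close> by (simp add: inner_mix zero_le_mult_iff)
  qed
  then have b0: "v \<bullet> b = 0" using up[OF b] in_Delta[OF b] by force
  have le: "v \<bullet> z \<le> 0" if "z \<in> Delta" for z
  proof -
    obtain d where "d > 0" "d \<le> 1" "\<And>t. 0 \<le> t \<Longrightarrow> t < d \<Longrightarrow> (mix t z b, p) \<in> S"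
      using open_upper_mix[OF b \<open>z \<in> Delta\<close>] by blast
    then have "(mix (d / 2) z b, p) \<in> S" by simp
    from up[OF this] show ?thesis using b0 \<open>d > 0\<close> by (simp add: inner_mix mult_le_0_iff)
  qed
  have "v $ i = 0" for i using ge le pure_Delta inner_pure by (metis order_antisym)
  then show False using v by (simp add: vec_eq_iff)
qed

lemma functional_exists:
  assumes a0: "(p, a0) \<in> S" and b0: "(b0, p) \<in> S"
  shows "\<exists>v. functional_at v p"
proof -
  define A where "A = lower S p"
  \<comment> \<open>Reflecting the upper set in the origin turns homogeneous separation of two sets
    into separation of \<open>0\<close> from one convex hull. It lies outside the hull because
    proportional outcomes are equal, their coordinate sums being one.\<close>
  define B where "B = uminus ` upper S p"
  have p: "p \<in> Delta" using a0 in_Delta by blast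
  have cA: "convex A" and cB: "convex B"
    using S p unfolding A_def B_def prefs_def pref_convex_def by (auto intro: convex_negations)
  have ne: "A \<noteq> {}" "B \<noteq> {}"
    using a0 b0 in_Delta[OF a0] in_Delta[OF b0] by (auto simp: A_def B_def lower_def upper_def)
  have "0 \<notin> convex hull (A \<union> B)"
  proof
    assume "0 \<in> convex hull (A \<union> B)"
    then obtain u w a b where ab: "0 = u *\<^sub>R a + w *\<^sub>R (- b)" "u \<ge> 0" "w \<ge> 0" "u + w = 1"
        "a \<in> lower S p" "b \<in> upper S p"
      unfolding convex_hull_union_two[OF cA ne(1) cB ne(2)] by (auto simp: A_def B_def)
    have ab': "u *\<^sub>R a = w *\<^sub>R b" using ab(1) by simp
    then have "u * (\<Sum>i\<in>UNIV. a $ i) = w * (\<Sum>i\<in>UNIV. b $ i)"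
      by (simp add: sum_distrib_left vec_eq_iff)
    then have "u = w" using ab by (simp add: lower_def upper_def sum_Delta)
    then have "a = b" using ab' ab by simp
    then show False using ab not_sym by (auto simp: lower_def upper_def)
  qed
  then obtain v where v: "v \<noteq> 0" "\<And>x. x \<in> convex hull (A \<union> B) \<Longrightarrow> 0 \<le> v \<bullet> x"
    using separating_hyperplane_set_0[OF convex_convex_hull, of "A \<union> B"] by blast
  have lo: "0 \<le> v \<bullet> a" if "(p, a) \<in> S" for a
    using that in_Delta by (intro v(2) hull_inc) (auto simp: A_def lower_def)
  have up: "v \<bullet> b \<le> 0" if "(b, p) \<in> S" for b
    using that in_Delta v(2)[of "- b"] by (force simp: B_def upper_def intro!: hull_inc)
  have lo': "0 < v \<bullet> a" if "(p, a) \<in> S" for a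
    using separation_strict[OF v(1) lo up that b0] .
  have up': "v \<bullet> b < 0" if "(b, p) \<in> S" for b
    using convex_pref.separation_strict[OF dual, of "- v" p b a0] v(1) lo up that a0 by auto
  have "v \<bullet> q = 0" if q: "q \<in> Delta" "indiff S p q" for q
  proof (rule ccontr)
    assume n: "v \<bullet> q \<noteq> 0"
    \<comment> \<open>\<open>y\<close> lies on the side of the hyperplane opposite to
      \<open>q\<close>, so some mixture of the two has value zero, although dominance makes it
      strictly comparable to \<open>p\<close>.\<close>
    define y where "y = (if v \<bullet> q > 0 then b0 else a0)"
    have y: "(v \<bullet> q) * (v \<bullet> y) < 0"
      using n lo'[OF a0] up'[OF b0] by (auto simp: y_def mult_less_0_iff)
    define t where "t = v \<bullet> q / (v \<bullet> q - v \<bullet> y)"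
    have t: "0 < t" "t \<le> 1" "t * (v \<bullet> y) + (1 - t) * (v \<bullet> q) = 0"
      using y n by (auto simp: t_def mult_less_0_iff divide_simps)
    have "(p, mix t y q) \<in> S \<or> (mix t y q, p) \<in> S"
      using dominance[OF a0 q t(1,2)] dominance'[OF b0 q t(1,2)] by (auto simp: y_def)
    then show False using lo' up' t(3) by (force simp: inner_mix)
  qed
  then have "functional_at v p"
    unfolding functional_at_def using lo' up' by (metis indiff_def less_irrefl not_less_iff_gr_or_eq)
  then show ?thesis by blast
qed

text \<open>Supplies the second strict comparison that separation needs: an interior
  \<open>p\<close> lies inside a segment from \<open>q\<close> to some \<open>r\<close>, and the
  ranking along that line keeps its direction.\<close>

lemma extend_beyond:
  assumes "p \<in> Delta_pos" "(p, q) \<in> S"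
  shows "\<exists>r. (r, p) \<in> S"
proof -
  have q: "q \<in> Delta" using in_Delta assms by auto
  obtain e where e: "e > 0" "\<And>s. \<bar>s\<bar> < e \<Longrightarrow> p + s *\<^sub>R (p - q) \<in> Delta"
    using Delta_pos_perturb[OF assms(1), of "p - q"] sum_Delta[OF q] sum_Delta[of p] assms(1)
    by (auto simp: sum_subtractf Delta_pos_Delta)
  define s where "s = e / 2"
  define r where "r = p + s *\<^sub>R (p - q)"
  have s: "s > 0" "\<bar>s\<bar> < e" using e by (auto simp: s_def)
  have r: "r \<in> Delta" using e(2)[OF s(2)] by (simp add: r_def)
  define t where "t = s / (1 + s)"
  have t: "0 < t" "t < 1" using s by (auto simp: t_def)
  have "(1 + s) *\<^sub>R mix t q r = (1 + s) *\<^sub>R p"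
    using s by (simp add: vec_eq_iff mix_def t_def r_def field_simps)
  then have pm: "mix t q r = p" using s by simp
  have "\<not> indiff S r q"
  proof
    assume "indiff S r q"
    then have "indiff S (mix t q r) (mix 1 q r)" using r q t by (intro indiff_segment) auto
    then show False using assms pm by (simp add: mix_def indiff_def)
  qed
  moreover have "(q, r) \<notin> S"
  proof
    assume "(q, r) \<in> S"
    then have "(q, mix (1 - t) r q) \<in> S" using t by (intro strict_part) auto
    then show False using assms not_sym pm mix_swap[of t q r] by simp
  qed
  ultimately have "(r, q) \<in> S" by (auto simp: indiff_def)
  then have "(r, mix t q r) \<in> S" using t by (intro strict_part) auto
  then show ?thesis using pm by auto
qed

lemma functional_interior:
  assumes "p \<in> Delta_pos"
  shows "\<exists>v. functional_at v p"
proof -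
  consider q where "(p, q) \<in> S" | q where "(q, p) \<in> S" | "\<forall>q. (p, q) \<notin> S \<and> (q, p) \<notin> S" by blast
  then show ?thesis
  proof cases
    case 1
    then show ?thesis using extend_beyond[OF assms] functional_exists by blast
  next
    case 2
    then show ?thesis
      using convex_pref.extend_beyond[OF dual assms, of q] functional_exists by auto
  next
    case 3
    then have "functional_at 0 p" by (simp add: functional_at_def)
    then show ?thesis by blast
  qed
qed

text \<open>Normalised by \<open>v \<bullet> d = 1\<close>, the functionals along a line in direction \<open>d\<close> are those of an
  SSB function up to a common factor; the symmetry axiom is what makes them affine.\<close>

lemma chord_midpoint:
  assumes M: "M \<in> Delta_pos" "M - (2 * e) *\<^sub>R d \<in> Delta_pos" "M + (2 * e) *\<^sub>R d \<in> Delta_pos"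
    and e: "e > 0" and d: "(\<Sum>a\<in>UNIV. d $ a) = 0"
    and u: "functional_at u M" "u \<bullet> d = 1"
    and u1: "functional_at u1 (M - e *\<^sub>R d)" "u1 \<bullet> d = 1"
    and u2: "functional_at u2 (M + e *\<^sub>R d)" "u2 \<bullet> d = 1"
    and q: "q \<in> Delta"
  shows "u1 \<bullet> q + u2 \<bullet> q = 2 * (u \<bullet> q)"
proof -
  \<comment> \<open>The direction \<open>w\<close> is annihilated by \<open>u\<close>, so moving
    from \<open>M\<close> along \<open>w\<close> yields outcomes \<open>Q\<close> indifferent to
    \<open>M\<close>; \<open>k\<close> is the value of \<open>u1\<close> at
    \<open>w\<close>.\<close>
  define h where "h = u \<bullet> q"
  define k where "k = u1 \<bullet> q - e - h"
  define w where "w = q - M - h *\<^sub>R d"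
  have MD: "M \<in> Delta" using M Delta_pos_Delta by blast
  have w0: "(\<Sum>a\<in>UNIV. w $ a) = 0"
    using d q MD by (simp add: w_def sum_subtractf sum_Delta flip: sum_distrib_left)
  obtain e1 where e1: "e1 > 0" "\<And>s. \<bar>s\<bar> < e1 \<Longrightarrow> M + s *\<^sub>R w \<in> Delta"
    using Delta_pos_perturb[OF M(1) w0] by blast
  obtain e2 where e2: "e2 > 0" "\<And>s. \<bar>s\<bar> < e2 \<Longrightarrow> M - (2 * e) *\<^sub>R d + s *\<^sub>R d \<in> Delta"
    using Delta_pos_perturb[OF M(2) d] by blast
  obtain e3 where e3: "e3 > 0" "\<And>s. \<bar>s\<bar> < e3 \<Longrightarrow> M + (2 * e) *\<^sub>R d + s *\<^sub>R d \<in> Delta"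
    using Delta_pos_perturb[OF M(3) d] by blast
  define m where "m = min (min e2 e3) e"
  have m: "m > 0" using e1 e2 e3 e by (simp add: m_def)
  define m' where "m' = m / (\<bar>k\<bar> + 1)"
  have m': "m' > 0" using m by (simp add: m'_def divide_pos_pos)
  define s where "s = min e1 m' / 2"
  have s: "s > 0" "s < e1" using e1 m' by (auto simp: s_def)
  have "s < m / (\<bar>k\<bar> + 1)" using e1 m' unfolding m'_def[symmetric] by (auto simp: s_def)
  then have "s * (\<bar>k\<bar> + 1) < m" by (subst (asm) pos_less_divide_eq) auto
  then have sk: "\<bar>s * k\<bar> < e2" "\<bar>s * k\<bar> < e3" "\<bar>s * k\<bar> < e"
    using s by (auto simp: abs_mult algebra_simps m_def)
  \<comment> \<open>Solves the condition that \<open>u1\<close> vanish at the midpoint of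
    \<open>P\<close> and \<open>Q\<close>, which is the second premise of the symmetry axiom. Small
    \<open>s\<close> keeps \<open>rho\<close> near \<open>2 * e\<close>, so that \<open>P\<close>
    and \<open>R\<close> stay in \<open>Delta\<close>.\<close>
  define rho where "rho = 2 * e + s * k"
  have rho: "rho > e" using sk by (simp add: rho_def)
  define P where "P = M - rho *\<^sub>R d"
  define R where "R = M + rho *\<^sub>R d"
  define Q where "Q = M + s *\<^sub>R w"
  have PD: "P \<in> Delta" using e2(2)[of "- (s * k)"] sk by (simp add: P_def rho_def algebra_simps)
  have RD: "R \<in> Delta" using e3(2)[of "s * k"] sk by (simp add: R_def rho_def algebra_simps)
  have QD: "Q \<in> Delta" using e1(2)[of s] s by (simp add: Q_def)
  \<comment> \<open>Chosen so that \<open>mix l P R\<close> and \<open>mix l R P\<close> are the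
    points at which \<open>u1\<close> and \<open>u2\<close> are functionals.\<close>
  define l where "l = (1 + e / rho) / 2"
  have l: "0 < l" "l < 1" using rho e by (auto simp: l_def field_simps)
  have lr: "(2 * l - 1) * rho = e" 
  proof -
    have "2 * l - 1 = e / rho" by (simp add: l_def field_simps)
    then show ?thesis using rho e by simp
  qed
  have mid: "mix (1/2) P R = M" by (simp add: vec_eq_iff mix_def P_def R_def field_simps)
  have XP: "mix l P R = M - e *\<^sub>R d"
  proof -
    have "mix l P R = M - ((2 * l - 1) * rho) *\<^sub>R d"
      by (simp add: vec_eq_iff mix_def P_def R_def algebra_simps)
    then show ?thesis using lr by simp
  qed
  have XR: "mix l R P = M + e *\<^sub>R d"
  proof -
    have "mix l R P = M + ((2 * l - 1) * rho) *\<^sub>R d"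
      by (simp add: vec_eq_iff mix_def P_def R_def algebra_simps)
    then show ?thesis using lr by simp
  qed
  have XD: "M - e *\<^sub>R d \<in> Delta" "M + e *\<^sub>R d \<in> Delta"
    using XP XR PD RD l mix_in_Delta less_imp_le by metis+
  have uM: "u \<bullet> M = 0" using functional_at_self[OF u(1) MD] .
  have u1M: "u1 \<bullet> M = e"
    using functional_at_self[OF u1(1) XD(1)] u1(2) by (simp add: inner_diff_right)
  have u2M: "u2 \<bullet> M = - e"
    using functional_at_self[OF u2(1) XD(2)] u2(2) by (simp add: inner_add_right)
  have 1: "indiff S Q (mix (1/2) P R)"
  proof -
    have "u \<bullet> Q = 0" by (simp add: Q_def w_def inner_add_right inner_diff_right uM u(2) h_def)
    then show ?thesis using functional_at_indiff[OF u(1) QD] indiff_sym mid by metis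
  qed
  have mD: "mix (1/2) P Q \<in> Delta" "mix (1/2) R Q \<in> Delta"
    using PD QD RD by (auto intro: mix_in_Delta)
  have 2: "indiff S (mix l P R) (mix (1/2) P Q)"
  proof -
    have "u1 \<bullet> mix (1/2) P Q = (2 * e - rho + s * k) / 2"
      by (simp add: inner_mix P_def Q_def w_def inner_add_right inner_diff_right u1M u1(2) k_def
          field_simps)
    then show ?thesis using functional_at_indiff[OF u1(1) mD(1)] XP by (simp add: rho_def)
  qed
  have "indiff S (mix l R P) (mix (1/2) R Q)" using symmetry[OF PD QD RD l 1 2] .
  then have "u2 \<bullet> mix (1/2) R Q = 0" using functional_at_indiff[OF u2(1) mD(2)] XR by simp
  moreover have "u2 \<bullet> mix (1/2) R Q = (s * k + s * (u2 \<bullet> q + e - h)) / 2"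
    by (simp add: inner_mix R_def Q_def w_def inner_add_right inner_diff_right u2M u2(2) rho_def
        field_simps)
  ultimately have "s * (k + (u2 \<bullet> q + e - h)) = 0" by (simp add: algebra_simps)
  then have "k + (u2 \<bullet> q + e - h) = 0" using s by simp
  then show ?thesis by (simp add: k_def h_def)
qed

end

lemma positive_near_zero:
  fixes a b d :: real
  assumes "d > 0" "\<And>t. 0 < t \<Longrightarrow> t < d \<Longrightarrow> 0 < t * a + (1 - t) * b"
  shows "0 \<le> b" "b = 0 \<Longrightarrow> 0 < a"
proof -
  show "0 \<le> b"
  proof (rule ccontr)
    assume b: "\<not> 0 \<le> b"
    define t where "t = min (d / 2) (- b / (\<bar>a - b\<bar> + 1))"
    have t: "0 < t" "t < d" using assms(1) b by (auto simp: t_def intro!: divide_neg_pos)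
    have "t \<le> - b / (\<bar>a - b\<bar> + 1)" by (simp add: t_def)
    then have "t * (\<bar>a - b\<bar> + 1) \<le> - b" by (subst (asm) pos_le_divide_eq) auto
    moreover have "t * (a - b) \<le> t * \<bar>a - b\<bar>" using t by (intro mult_left_mono) auto
    ultimately show False using assms(2)[OF t] t by (simp add: algebra_simps)
  qed
  show "0 < a" if "b = 0"
    using assms(2)[of "d / 2"] assms(1) that by (simp add: zero_less_mult_iff)
qed

section \<open>Chords: continuity, affinity and the cocycle identity\<close>

context convex_pref
begin

lemma functional_at_dual: "convex_pref.functional_at (S\<inverse>) (- v) p \<longleftrightarrow> functional_at v p"
  unfolding functional_at_def convex_pref.functional_at_def[OF dual] by auto

lemma functional_at_swap:
  assumes "functional_at v p" "functional_at w q" "p \<in> Delta" "q \<in> Delta"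
  shows "0 < v \<bullet> q \<longleftrightarrow> w \<bullet> p < 0" "v \<bullet> q < 0 \<longleftrightarrow> 0 < w \<bullet> p" "v \<bullet> q = 0 \<longleftrightarrow> w \<bullet> p = 0"
  using assms unfolding functional_at_def by (metis linorder_neqE_linordered_idom less_irrefl)+

text \<open>Justifies the normalisation: along a chord with strictly ranked ends, every functional
  is nonzero on the direction of the chord, with the same sign throughout.\<close>

lemma chord_positive:
  assumes "(p, r) \<in> S" "0 \<le> t" "t \<le> 1" "functional_at u (mix t r p)"
  shows "0 < u \<bullet> (r - p)"
proof -
  have D: "p \<in> Delta" "r \<in> Delta" using assms in_Delta by auto
  then have xD: "mix t r p \<in> Delta" using assms by (auto intro: mix_in_Delta)
  have 0: "t * (u \<bullet> r) + (1 - t) * (u \<bullet> p) = 0"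
    using functional_at_self[OF assms(4) xD] by (simp add: inner_mix)
  show ?thesis
  proof (cases "t = 1")
    case True
    then have "(p, mix t r p) \<in> S" using assms by (simp add: mix_def)
    then have "u \<bullet> p < 0" using assms(4) D by (simp add: functional_at_def)
    then show ?thesis using 0 True by (simp add: inner_diff_right)
  next
    case False
    then have "(mix t r p, mix 1 r p) \<in> S" using assms by (intro strict_segment) auto
    then have "0 < u \<bullet> r" using assms(4) D by (simp add: functional_at_def mix_def[of 1])
    moreover have "(1 - t) * (u \<bullet> (r - p)) = u \<bullet> r"
      using 0 by (simp add: inner_diff_right algebra_simps)
    ultimately have "0 < (1 - t) * (u \<bullet> (r - p))" by simp
    then show ?thesis using False assms by (simp add: zero_less_mult_iff)
  qed
qed

text \<open>Separation gives no control over how functionals vary; only strict preference is known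
  to be open. The threshold \<open>c\<close> is therefore encoded in an outcome \<open>y\<close>
  whose comparison with the chord point tells on which side of \<open>c\<close> the value
  \<open>v t \<bullet> q\<close> lies, up to an error linear in \<open>t - t0\<close>. The sign
  \<open>s\<close> treats lower and upper bounds at once.\<close>

lemma chord_semicontinuous:
  assumes D: "p \<in> Delta_pos" "r \<in> Delta_pos" "q \<in> Delta"
    and v: "\<And>t. t \<in> {0..1} \<Longrightarrow> functional_at (v t) (mix t r p)"
      "\<And>t. t \<in> {0..1} \<Longrightarrow> v t \<bullet> (r - p) = 1"
    and t0: "t0 \<in> {0..1}" and s: "s = 1 \<or> s = - 1" and c: "0 < s * (v t0 \<bullet> q - c)"
  shows "\<exists>e>0. \<exists>K\<ge>0. \<forall>t\<in>{0..1}. \<bar>t - t0\<bar> < e \<longrightarrow> - (K * \<bar>t - t0\<bar>) < s * (v t \<bullet> q - c)"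
proof -
  define d where "d = r - p"
  define x where "x t = mix t r p" for t
  have x: "x t = x t' + (t - t') *\<^sub>R d" for t t'
    by (simp add: x_def d_def mix_def algebra_simps)
  have xpos: "x t \<in> Delta_pos" if "t \<in> {0..1}" for t
    using that D by (auto simp: x_def intro: mix_Delta_pos')
  have xD: "x t \<in> Delta" if "t \<in> {0..1}" for t using xpos[OF that] Delta_pos_Delta by blast
  have D': "p \<in> Delta" "r \<in> Delta" using D Delta_pos_Delta by auto
  define w where "w = q - x t0 - c *\<^sub>R d"
  have "(\<Sum>a\<in>UNIV. w $ a) = 0"
    using D(3) D' xD[OF t0] by (simp add: w_def d_def sum_subtractf sum_Delta flip: sum_distrib_left)
  then obtain e0 where e0: "e0 > 0" "\<And>s. \<bar>s\<bar> < e0 \<Longrightarrow> x t0 + s *\<^sub>R w \<in> Delta"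
    using Delta_pos_perturb[OF xpos[OF t0]] by blast
  define e where "e = min e0 1 / 2"
  have e: "0 < e" "e < 1" "e < e0" using e0 by (auto simp: e_def)
  define y where "y = x t0 + e *\<^sub>R w"
  have yD: "y \<in> Delta" using e0(2)[of e] e by (simp add: y_def)
  have vx: "v t \<bullet> x t0 = t0 - t" if "t \<in> {0..1}" for t
    using functional_at_self[OF v(1)[OF that]] xD[OF that] v(2)[OF that] x[of t0 t]
    by (simp add: x_def d_def inner_add_right)
  have vy: "v t \<bullet> y = (1 - e) * (t0 - t) + e * (v t \<bullet> q - c)" if "t \<in> {0..1}" for t
  proof -
    have vd: "v t \<bullet> d = 1" using v(2)[OF that] by (simp add: d_def)
    have "v t \<bullet> y = v t \<bullet> x t0 + e * (v t \<bullet> q - v t \<bullet> x t0 - c)"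
      by (simp add: y_def w_def inner_add_right inner_diff_right vd)
    then show ?thesis unfolding vx[OF that] by (simp add: algebra_simps)
  qed
  define above where "above z \<longleftrightarrow> (if s = 1 then (z, y) \<in> S else (y, z) \<in> S)" for z
  have above: "above (x t) \<longleftrightarrow> 0 < s * (v t \<bullet> y)" if "t \<in> {0..1}" for t
  proof -
    have "(x t, y) \<in> S \<longleftrightarrow> 0 < v t \<bullet> y" "(y, x t) \<in> S \<longleftrightarrow> v t \<bullet> y < 0"
      using v(1)[OF that] yD by (auto simp: functional_at_def x_def)
    then show ?thesis using s by (elim disjE) (simp_all add: above_def)
  qed
  have "0 < e * (s * (v t0 \<bullet> q - c))" using e c by simp
  then have "above (x t0)" using above[OF t0] vy[OF t0] by (simp add: mult.left_commute)
  then have "\<exists>n>0. \<forall>z\<in>Delta. dist z (x t0) < n \<longrightarrow> above z"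
    using open_lower[of y "x t0"] open_upper[of "x t0" y] by (cases "s = 1") (simp_all add: above_def)
  then obtain n where n: "n > 0" "\<And>z. z \<in> Delta \<Longrightarrow> dist z (x t0) < n \<Longrightarrow> above z"
    by blast
  define eta where "eta = n / (norm d + 1)"
  have nd: "norm d + 1 > 0" by (simp add: add_nonneg_pos)
  have eta: "eta > 0" using n nd by (simp add: eta_def)
  have "- ((1 - e) / e * \<bar>t - t0\<bar>) < s * (v t \<bullet> q - c)" if t: "t \<in> {0..1}" "\<bar>t - t0\<bar> < eta" for t
  proof -
    have "\<bar>t - t0\<bar> * (norm d + 1) < n" using t(2) nd by (simp add: eta_def pos_less_divide_eq)
    moreover have "dist (x t) (x t0) = \<bar>t - t0\<bar> * norm d"
      by (simp add: dist_norm x[of t t0])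
    ultimately have "dist (x t) (x t0) < n"
      using abs_ge_zero[of "t - t0"] by (simp add: distrib_left)
    then have "0 < s * (v t \<bullet> y)" using n(2) xD above t by blast
    then have "0 < s * ((1 - e) * (t0 - t)) + e * (s * (v t \<bullet> q - c))"
      using vy[OF t(1)] by (simp add: algebra_simps)
    moreover have "s * ((1 - e) * (t0 - t)) \<le> (1 - e) * \<bar>t - t0\<bar>"
    proof -
      have "s * (t0 - t) \<le> \<bar>t - t0\<bar>" using s by auto
      then have "(1 - e) * (s * (t0 - t)) \<le> (1 - e) * \<bar>t - t0\<bar>" using e by (intro mult_left_mono) auto
      then show ?thesis by (simp add: mult.left_commute)
    qed
    ultimately have "- ((1 - e) * \<bar>t - t0\<bar>) < e * (s * (v t \<bullet> q - c))" by linarith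
    then show ?thesis using e by (simp add: field_simps)
  qed
  moreover have "(1 - e) / e \<ge> 0" using e by simp
  ultimately show ?thesis using eta by blast
qed

lemma chord_continuous:
  assumes D: "p \<in> Delta_pos" "r \<in> Delta_pos" "q \<in> Delta"
    and v: "\<And>t. t \<in> {0..1} \<Longrightarrow> functional_at (v t) (mix t r p)"
      "\<And>t. t \<in> {0..1} \<Longrightarrow> v t \<bullet> (r - p) = 1"
  shows "continuous_on {0..1} (\<lambda>t. v t \<bullet> q)"
  unfolding continuous_on_iff
proof (intro ballI allI impI)
  fix t0 e :: real
  assume t0: "t0 \<in> {0..1}" and e: "0 < e"
  have *: "\<exists>d>0. \<forall>t\<in>{0..1}. \<bar>t - t0\<bar> < d \<longrightarrow> - e < s * (v t \<bullet> q - v t0 \<bullet> q)"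
    if s: "s = 1 \<or> s = - 1" for s
  proof -
    have ss: "s * s = 1" using s by auto
    \<comment> \<open>Half of the tolerance separates \<open>c\<close> from the value at
      \<open>t0\<close>; the other half absorbs the linear error
      \<open>K * \<bar>t - t0\<bar>\<close>.\<close>
    define c where "c = v t0 \<bullet> q - s * (e / 2)"
    have "0 < s * (v t0 \<bullet> q - c)" using ss e by (simp add: c_def flip: mult.assoc)
    from chord_semicontinuous[OF D v t0 s this]
    obtain n K where n: "n > 0" "K \<ge> 0"
      "\<And>t. t \<in> {0..1} \<Longrightarrow> \<bar>t - t0\<bar> < n \<Longrightarrow> - (K * \<bar>t - t0\<bar>) < s * (v t \<bullet> q - c)" by blast
    define d where "d = min n (e / (2 * (K + 1)))"
    have d: "d > 0" using n e by (simp add: d_def)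
    have "- e < s * (v t \<bullet> q - v t0 \<bullet> q)" if t: "t \<in> {0..1}" "\<bar>t - t0\<bar> < d" for t
    proof -
      define a where "a = \<bar>t - t0\<bar>"
      have a: "0 \<le> a" "a < n" "a < e / (2 * (K + 1))" using t by (simp_all add: a_def d_def)
      from a(3) have "a * (2 * (K + 1)) < e" using n by (subst (asm) pos_less_divide_eq) auto
      then have "2 * (K * a) + 2 * a < e" by (simp add: algebra_simps)
      then have "K * a < e / 2" using a(1) by linarith
      moreover have "s * (v t \<bullet> q - c) = s * (v t \<bullet> q - v t0 \<bullet> q) + (s * s) * (e / 2)"
        by (simp add: c_def algebra_simps)
      moreover have "- (K * a) < s * (v t \<bullet> q - c)" using n(3)[OF t(1)] a(2) by (simp add: a_def)
      ultimately show ?thesis unfolding ss by linarith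
    qed
    then show ?thesis using d by blast
  qed
  obtain d1 where d1: "d1 > 0" "\<And>t. t \<in> {0..1} \<Longrightarrow> \<bar>t - t0\<bar> < d1 \<Longrightarrow> - e < v t \<bullet> q - v t0 \<bullet> q"
    using *[of 1] by auto
  obtain d2 where d2: "d2 > 0" "\<And>t. t \<in> {0..1} \<Longrightarrow> \<bar>t - t0\<bar> < d2 \<Longrightarrow> - e < - (v t \<bullet> q - v t0 \<bullet> q)"
    using *[of "- 1"] by auto
  show "\<exists>d>0. \<forall>t\<in>{0..1}. dist t t0 < d \<longrightarrow> dist (v t \<bullet> q) (v t0 \<bullet> q) < e"
    using d1 d2 by (intro exI[of _ "min d1 d2"]) (force simp: dist_real_def abs_less_iff)
qed

lemma chord_affine:
  assumes D: "p \<in> Delta_pos" "r \<in> Delta_pos" "q \<in> Delta"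
    and v: "\<And>t. t \<in> {0..1} \<Longrightarrow> functional_at (v t) (mix t r p)"
      "\<And>t. t \<in> {0..1} \<Longrightarrow> v t \<bullet> (r - p) = 1"
    and t: "t \<in> {0..1}"
  shows "v t \<bullet> q = (1 - t) * (v 0 \<bullet> q) + t * (v 1 \<bullet> q)"
proof (rule midpoint_affine[OF chord_continuous[OF D v] _ t, simplified])
  fix s e :: real
  assume e: "0 < e" "2 * e \<le> s" "s + 2 * e \<le> 1"
  have D': "p \<in> Delta" "r \<in> Delta" using D Delta_pos_Delta by auto
  have x: "mix s r p + a *\<^sub>R (r - p) = mix (s + a) r p" for a
    by (simp add: mix_def algebra_simps)
  have x': "mix s r p - a *\<^sub>R (r - p) = mix (s - a) r p" for a
    by (simp add: mix_def algebra_simps)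
  show "v (s - e) \<bullet> q + v (s + e) \<bullet> q = 2 * (v s \<bullet> q)"
    using e D D' v
    by (intro chord_midpoint[of "mix s r p" e "r - p"])
      (auto simp: x x' sum_subtractf sum_Delta intro: mix_Delta_pos')
qed

text \<open>By \<open>mid\<close> the chord from \<open>p\<close> to \<open>r\<close> contains a
  point indifferent to \<open>q\<close>. The functional there vanishes at \<open>q\<close>, and by
  affinity this value is the mixture of the values at \<open>q\<close> of the normalised
  \<open>u\<close> and \<open>w\<close>; clearing denominators gives the identity.\<close>

lemma cocycle_chord:
  assumes D: "p \<in> Delta_pos" "q \<in> Delta_pos" "r \<in> Delta_pos" and pr: "(p, r) \<in> S"
    and f: "functional_at u p" "functional_at v q" "functional_at w r"
    and mid: "(v \<bullet> p) * (v \<bullet> r) < 0"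
  shows "(u \<bullet> q) * (v \<bullet> r) * (w \<bullet> p) = - ((v \<bullet> p) * (w \<bullet> q) * (u \<bullet> r))"
proof -
  have D': "p \<in> Delta" "q \<in> Delta" "r \<in> Delta" using D Delta_pos_Delta by auto
  have ur: "0 < u \<bullet> r" and wp: "w \<bullet> p < 0"
    using pr f D' by (auto simp: functional_at_def)
  have ex: "\<exists>z. functional_at z (mix t r p) \<and> z \<bullet> (r - p) = 1" if t: "t \<in> {0..1}" for t
  proof -
    have "mix t r p \<in> Delta_pos" using D t by (auto intro: mix_Delta_pos')
    then obtain z where z: "functional_at z (mix t r p)" using functional_interior by blast
    then have "0 < z \<bullet> (r - p)" using chord_positive[OF pr] t by auto
    then show ?thesis using z
      by (intro exI[of _ "(1 / (z \<bullet> (r - p))) *\<^sub>R z"]) (auto intro: functional_at_scale)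
  qed
  \<comment> \<open>As each functional vanishes at its own point,
    \<open>u \<bullet> (r - p) = u \<bullet> r\<close> and
    \<open>w \<bullet> (r - p) = - (w \<bullet> p)\<close>. The ends are set explicitly so that
    \<open>u\<close> and \<open>w\<close> themselves appear in the result.\<close>
  define V where "V t = (if t = 0 then (1 / (u \<bullet> r)) *\<^sub>R u else if t = 1 then (- 1 / (w \<bullet> p)) *\<^sub>R w
      else SOME z. functional_at z (mix t r p) \<and> z \<bullet> (r - p) = 1)" for t :: real
  have V: "functional_at (V t) (mix t r p) \<and> V t \<bullet> (r - p) = 1" if "t \<in> {0..1}" for t
  proof -
    consider "t = 0" | "t = 1" | "t \<noteq> 0" "t \<noteq> 1" by blast
    then show ?thesis
    proof cases
      case 1
      then have "mix t r p = p" by (simp add: mix_def)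
      then show ?thesis using 1 ur f functional_at_self[OF f(1) D'(1)]
        by (simp add: V_def functional_at_scale inner_diff_right)
    next
      case 2
      then have "mix t r p = r" by (simp add: mix_def)
      moreover have "functional_at ((- 1 / (w \<bullet> p)) *\<^sub>R w) r"
        using wp f(3) by (intro functional_at_scale) (auto intro: divide_neg_neg)
      ultimately show ?thesis using 2 wp functional_at_self[OF f(3) D'(3)]
        by (simp add: V_def inner_diff_right)
    next
      case 3
      then show ?thesis using someI_ex[OF ex[OF that]] by (simp add: V_def)
    qed
  qed
  define t where "t = (v \<bullet> p) / (v \<bullet> p - v \<bullet> r)"
  have nz: "v \<bullet> p - v \<bullet> r \<noteq> 0" using mid by (metis eq_iff_diff_eq_0 not_square_less_zero)
  have t: "t \<in> {0..1}" using mid nz by (auto simp: t_def mult_less_0_iff divide_simps)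
  have t1: "(v \<bullet> p - v \<bullet> r) * t = v \<bullet> p" "(v \<bullet> p - v \<bullet> r) * (1 - t) = - (v \<bullet> r)"
    using nz by (auto simp: t_def field_simps)
  have xD: "mix t r p \<in> Delta" using D' t by (auto intro: mix_in_Delta)
  have "(v \<bullet> p - v \<bullet> r) * (v \<bullet> mix t r p) = 0"
    unfolding inner_mix distrib_left mult.assoc[symmetric] t1 by simp
  then have "indiff S q (mix t r p)" using nz functional_at_indiff[OF f(2) xD] by simp
  then have "V t \<bullet> q = 0" using V[OF t] functional_at_indiff D' indiff_sym by blast
  then have "(1 - t) * (V 0 \<bullet> q) + t * (V 1 \<bullet> q) = 0"
    using chord_affine[OF D(1,3) D'(2), of V t] V t by simp
  then have "(v \<bullet> p - v \<bullet> r) * ((1 - t) * (V 0 \<bullet> q) + t * (V 1 \<bullet> q)) = 0" by simp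
  then have "- (v \<bullet> r) * (V 0 \<bullet> q) + (v \<bullet> p) * (V 1 \<bullet> q) = 0"
    unfolding distrib_left mult.assoc[symmetric] t1 .
  then show ?thesis using ur wp by (simp add: V_def field_simps)
qed

lemma cocycle_mid:
  assumes D: "p \<in> Delta_pos" "q \<in> Delta_pos" "r \<in> Delta_pos" and pr: "u \<bullet> r \<noteq> 0"
    and f: "functional_at u p" "functional_at v q" "functional_at w r"
    and mid: "(v \<bullet> p) * (v \<bullet> r) < 0"
  shows "(u \<bullet> q) * (v \<bullet> r) * (w \<bullet> p) = - ((v \<bullet> p) * (w \<bullet> q) * (u \<bullet> r))"
proof -
  have "r \<in> Delta" using D Delta_pos_Delta by blast
  then have "(p, r) \<in> S \<or> (r, p) \<in> S" using pr f(1) by (force simp: functional_at_def)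
  then show ?thesis
    using cocycle_chord[OF D _ f mid] cocycle_chord[OF D(3,2,1) _ f(3,2,1)] mid
    by (auto simp: algebra_simps)
qed

text \<open>Among three pairwise strictly ranked outcomes, transitive or cyclic, some one beats one
  of the others and loses to the other; the chord argument applies with it in the role of
  \<open>q\<close>.\<close>

lemma cocycle:
  assumes D: "p \<in> Delta_pos" "q \<in> Delta_pos" "r \<in> Delta_pos"
    and nz: "u \<bullet> q \<noteq> 0" "v \<bullet> r \<noteq> 0" "w \<bullet> p \<noteq> 0"
    and f: "functional_at u p" "functional_at v q" "functional_at w r"
  shows "(u \<bullet> q) * (v \<bullet> r) * (w \<bullet> p) = - ((v \<bullet> p) * (w \<bullet> q) * (u \<bullet> r))"
proof -
  have D': "p \<in> Delta" "q \<in> Delta" "r \<in> Delta" using D Delta_pos_Delta by auto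
  note sw = functional_at_swap[OF f(1,2) D'(1,2)] functional_at_swap[OF f(2,3) D'(2,3)]
    functional_at_swap[OF f(3,1) D'(3,1)]
  consider "(v \<bullet> p) * (v \<bullet> r) < 0" | "(w \<bullet> q) * (w \<bullet> p) < 0" | "(u \<bullet> r) * (u \<bullet> q) < 0"
    using nz sw by (smt (verit) mult_less_0_iff)
  then show ?thesis
  proof cases
    case 1
    then show ?thesis using cocycle_mid[OF D _ f] sw nz by blast
  next
    case 2
    then show ?thesis
      using cocycle_mid[OF D(2,3,1) _ f(2,3,1)] sw nz by (simp add: algebra_simps)
  next
    case 3
    then show ?thesis
      using cocycle_mid[OF D(3,1,2) _ f(3,1,2)] sw nz by (simp add: algebra_simps)
  qed
qed

end

section \<open>The representing matrix\<close>

lemma positive_mix_near: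
  fixes a b :: real
  assumes "0 < b"
  shows "\<exists>d>0. \<forall>t. 0 < t \<longrightarrow> t < d \<longrightarrow> 0 < t * a + (1 - t) * b"
proof -
  have p: "0 < \<bar>a\<bar> + b" using assms by (simp add: add_nonneg_pos)
  have "0 < t * a + (1 - t) * b" if t: "0 < t" "t < b / (\<bar>a\<bar> + b)" for t
  proof -
    have "t * (\<bar>a\<bar> + b) < b" using t(2) unfolding pos_less_divide_eq[OF p] .
    moreover have "t * (- a) \<le> t * \<bar>a\<bar>" using t by (intro mult_left_mono) auto
    ultimately show ?thesis by (simp add: algebra_simps)
  qed
  then show ?thesis using assms p by (intro exI[of _ "b / (\<bar>a\<bar> + b)"]) simp
qed

definition bil :: "('a::finite \<Rightarrow> 'a \<Rightarrow> real) \<Rightarrow> real ^ 'a \<Rightarrow> real ^ 'a \<Rightarrow> real" where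
  "bil M p q = (\<Sum>a\<in>UNIV. \<Sum>b\<in>UNIV. M a b * p $ a * q $ b)"

text \<open>An SSB function is determined by its values at pure outcomes. Representations are kept
  as skew matrices because the aggregation compares their entries.\<close>

definition ssb_matrix :: "('a::finite \<Rightarrow> 'a \<Rightarrow> real) \<Rightarrow> 'a pref \<Rightarrow> bool" where
  "ssb_matrix M S \<longleftrightarrow> (\<forall>a b. M a b = - M b a) \<and> S \<subseteq> Delta \<times> Delta \<and>
     (\<forall>p\<in>Delta. \<forall>q\<in>Delta. (p, q) \<in> S \<longleftrightarrow> 0 < bil M p q)"

lemma span_pure: "(\<And>a. pure a \<in> span G) \<Longrightarrow> x \<in> span G"
proof -
  assume a: "\<And>a. pure a \<in> span G"
  have "x = (\<Sum>i\<in>UNIV. x $ i *\<^sub>R pure i)"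
    by (simp add: vec_eq_iff pure_def axis_def if_distrib cong: if_cong)
  moreover have "(\<Sum>i\<in>UNIV. x $ i *\<^sub>R pure i) \<in> span G"
    by (intro span_sum span_scale a)
  ultimately show ?thesis by simp
qed

lemma bil_linear_form:
  assumes "linear g"
  shows "bil (\<lambda>a b. g (pure a) \<bullet> pure b) p q = g p \<bullet> q"
proof -
  have e: "x = (\<Sum>i\<in>UNIV. x $ i *\<^sub>R pure i)" for x :: "real ^ 'a"
    by (simp add: vec_eq_iff pure_def axis_def if_distrib cong: if_cong)
  have "g (\<Sum>i\<in>UNIV. p $ i *\<^sub>R pure i) \<bullet> q = (\<Sum>a\<in>UNIV. p $ a * (g (pure a) \<bullet> q))"
    by (simp add: linear_sum[OF assms] linear_cmul[OF assms] inner_sum_left)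
  then have 1: "g p \<bullet> q = (\<Sum>a\<in>UNIV. p $ a * (g (pure a) \<bullet> q))"
    unfolding e[symmetric] .
  have "x \<bullet> (\<Sum>i\<in>UNIV. q $ i *\<^sub>R pure i) = (\<Sum>b\<in>UNIV. q $ b * (x \<bullet> pure b))" for x :: "real ^ 'a"
    by (simp add: inner_sum_right)
  then have 2: "x \<bullet> q = (\<Sum>b\<in>UNIV. q $ b * (x \<bullet> pure b))" for x :: "real ^ 'a"
    unfolding e[symmetric] .
  show ?thesis unfolding 1 unfolding 2[of "g (pure _)"]
    by (simp add: bil_def sum_distrib_left mult_ac)
qed

text \<open>\<open>G\<close> may be linearly dependent, so the linear extension from a basis need
  not agree with \<open>F\<close> on the rest of \<open>G\<close>. Skewness forces it to: for fixed
  \<open>q\<close> in \<open>G\<close>, \<open>F p \<bullet> q\<close> equals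
  \<open>- (F q \<bullet> p)\<close>, which is linear in \<open>p\<close>.\<close>

lemma skew_linear_extension:
  fixes F :: "real ^ 'a::finite \<Rightarrow> real ^ 'a"
  assumes span: "\<And>x. x \<in> span G"
    and skew: "\<And>p q. p \<in> G \<Longrightarrow> q \<in> G \<Longrightarrow> F p \<bullet> q = - (F q \<bullet> p)"
  obtains g where "linear g" "\<And>p. p \<in> G \<Longrightarrow> g p = F p" "\<And>p q. g p \<bullet> q = - (g q \<bullet> p)"
proof -
  obtain B where B: "B \<subseteq> G" "independent B" "G \<subseteq> span B"
    using maximal_independent_subset[of G] by blast
  obtain g where g: "linear g" "\<And>x. x \<in> B \<Longrightarrow> g x = F x"
    using linear_independent_extend[OF B(2)] by blast
  note lin = linear_add[OF g(1)] linear_cmul[OF g(1)] linear_0[OF g(1)]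
  have all: "x \<in> T" if "subspace T" "A \<subseteq> T" "\<And>x. x \<in> span A" for T A and x :: "real ^ 'a"
    using span_minimal[OF that(2,1)] that(3) by blast
  have spanB: "x \<in> span B" for x using all[OF _ B(3) span] by simp
  have gF: "g p = F p" if p: "p \<in> G" for p
  proof -
    have 1: "g p \<bullet> q = F p \<bullet> q" if q: "q \<in> G" for q
    proof -
      have "p \<in> {z. g z \<bullet> q = - (F q \<bullet> z)}"
      proof (rule all[OF _ _ spanB])
        show "subspace {z. g z \<bullet> q = - (F q \<bullet> z)}"
          by (simp add: subspace_def lin inner_add_left inner_add_right algebra_simps)
        show "B \<subseteq> {z. g z \<bullet> q = - (F q \<bullet> z)}" using g(2) B(1) skew q by fastforce
      qed
      then show ?thesis using skew[OF p q] by simp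
    qed
    have "g p - F p \<in> {z. g p \<bullet> z = F p \<bullet> z}"
    proof (rule all[OF _ _ span])
      show "subspace {z. g p \<bullet> z = F p \<bullet> z}" by (simp add: subspace_def inner_add_right)
    qed (use 1 in auto)
    then have "(g p - F p) \<bullet> (g p - F p) = 0" by (simp add: inner_diff_left)
    then show ?thesis by simp
  qed
  have 2: "g p \<bullet> q = - (g q \<bullet> p)" if q: "q \<in> G" for p q
  proof -
    have "p \<in> {z. g z \<bullet> q = - (g q \<bullet> z)}"
    proof (rule all[OF _ _ span])
      show "subspace {z. g z \<bullet> q = - (g q \<bullet> z)}"
        by (simp add: subspace_def lin inner_add_left inner_add_right algebra_simps)
      show "G \<subseteq> {z. g z \<bullet> q = - (g q \<bullet> z)}"
      proof
        fix z assume "z \<in> G"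
        then show "z \<in> {z. g z \<bullet> q = - (g q \<bullet> z)}" using skew[of z q] gF q by simp
      qed
    qed
    then show ?thesis by simp
  qed
  have "g p \<bullet> q = - (g q \<bullet> p)" for p q
  proof -
    have "q \<in> {z. g p \<bullet> z = - (g z \<bullet> p)}"
    proof (rule all[OF _ _ span])
      show "subspace {z. g p \<bullet> z = - (g z \<bullet> p)}"
        by (simp add: subspace_def lin inner_add_left inner_add_right algebra_simps)
      show "G \<subseteq> {z. g p \<bullet> z = - (g z \<bullet> p)}" using 2 by blast
    qed
    then show ?thesis by simp
  qed
  then show ?thesis using that g(1) gF by blast
qed

section \<open>From interior points to the whole simplex\<close>

context convex_pref
begin

text \<open>Nothing is known about \<open>g p\<close> directly when \<open>p\<close> is outside
  \<open>G\<close>. Points of \<open>G\<close> near \<open>q\<close> do have functionals; skewness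
  turns their comparison with \<open>p\<close> into values of \<open>g p\<close>, and the limit at
  \<open>q\<close> costs strictness.\<close>

lemma extend_functional_weak:
  assumes skew: "\<And>p q. g p \<bullet> q = - (g q \<bullet> p)"
    and G: "z \<in> G" "z \<in> Delta" "\<exists>d>0. \<forall>t. 0 < t \<longrightarrow> t < d \<longrightarrow> mix t z q \<in> G"
    and ag: "\<And>p. p \<in> G \<Longrightarrow> functional_at (g p) p"
    and pq: "(p, q) \<in> S"
  shows "0 \<le> g p \<bullet> q" "g p \<bullet> q = 0 \<Longrightarrow> 0 < g p \<bullet> z"
proof -
  obtain d1 where d1: "d1 > 0" "\<And>t. 0 < t \<Longrightarrow> t < d1 \<Longrightarrow> mix t z q \<in> G" using G by blast
  obtain d2 where d2: "d2 > 0" "\<And>t. 0 \<le> t \<Longrightarrow> t < d2 \<Longrightarrow> (p, mix t z q) \<in> S"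
    using open_lower_mix[OF pq G(2)] by blast
  have "0 < t * (g p \<bullet> z) + (1 - t) * (g p \<bullet> q)" if t: "0 < t" "t < min d1 d2" for t
  proof -
    have "g (mix t z q) \<bullet> p < 0"
      using ag[OF d1(2)[of t]] d2(2)[of t] t in_Delta[OF pq] by (auto simp: functional_at_def)
    then show ?thesis using skew[of p "mix t z q"] by (simp add: inner_mix)
  qed
  from positive_near_zero[of "min d1 d2", OF _ this] d1(1) d2(1)
  show "0 \<le> g p \<bullet> q" "g p \<bullet> q = 0 \<Longrightarrow> 0 < g p \<bullet> z" by auto
qed

text \<open>If \<open>g p\<close> vanished at \<open>q\<close>, then \<open>g m\<close> would vanish
  at both ends for the midpoint \<open>m\<close>. The limit argument towards \<open>q\<close>, and
  for the converse preference towards \<open>p\<close>, would give \<open>g m \<bullet> z\<close>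
  both signs.\<close>

lemma extend_functional_strict:
  assumes skew: "\<And>p q. g p \<bullet> q = - (g q \<bullet> p)"
    and G: "z \<in> G" "z \<in> Delta" "\<And>q. q \<in> Delta \<Longrightarrow> \<exists>d>0. \<forall>t. 0 < t \<longrightarrow> t < d \<longrightarrow> mix t z q \<in> G"
    and ag: "\<And>p. p \<in> G \<Longrightarrow> functional_at (g p) p"
    and pq: "(p, q) \<in> S"
  shows "0 < g p \<bullet> q"
proof (rule ccontr)
  have D: "p \<in> Delta" "q \<in> Delta" using in_Delta pq by auto
  assume "\<not> 0 < g p \<bullet> q"
  then have "g p \<bullet> q = 0"
    using extend_functional_weak(1)[OF skew G(1,2) G(3) ag pq] D by force
  then have "g q \<bullet> p = 0" "g p \<bullet> p = 0" "g q \<bullet> q = 0"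
    using skew[of q p] skew[of p p] skew[of q q] by auto
  define m where "m = mix (1/2) q p"
  have pm: "(p, m) \<in> S" "(m, q) \<in> S"
    using strict_segment[OF pq, of 0 "1/2"] strict_segment[OF pq, of "1/2" 1]
    by (auto simp: m_def mix_def)
  have "g m \<bullet> q = 0" "g m \<bullet> p = 0"
    using skew[of m q] skew[of m p] \<open>g p \<bullet> q = 0\<close> \<open>g q \<bullet> p = 0\<close> \<open>g p \<bullet> p = 0\<close> \<open>g q \<bullet> q = 0\<close>
    by (simp_all add: m_def inner_mix)
  have "0 < g m \<bullet> z"
    using extend_functional_weak(2)[OF skew G(1,2) G(3) ag pm(2)] D \<open>g m \<bullet> q = 0\<close> by blast
  moreover have "0 < - g m \<bullet> z"
  proof (rule convex_pref.extend_functional_weak(2)[OF dual, where g = "\<lambda>p. - g p"])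
    show "- g p \<bullet> q = - (- g q \<bullet> p)" for p q using skew[of p q] by simp
    show "\<exists>d>0. \<forall>t. 0 < t \<longrightarrow> t < d \<longrightarrow> mix t z p \<in> G" using G(3)[OF D(1)] .
    show "convex_pref.functional_at (S\<inverse>) (- g x) x" if "x \<in> G" for x
      using ag[OF that] functional_at_dual by blast
    show "(m, p) \<in> S\<inverse>" using pm(1) by simp
    show "- g m \<bullet> p = 0" using \<open>g m \<bullet> p = 0\<close> by simp
  qed (rule G)+
  ultimately show False by simp
qed

text \<open>A positive value would give \<open>g m\<close> opposite signs at the two ends,
  \<open>m\<close> being the midpoint. The ends shifted slightly towards \<open>z\<close> would be
  strictly worse and strictly better than \<open>m\<close>, so \<open>m\<close> would have a
  functional; it vanishes at \<open>p\<close> and \<open>q\<close>, hence would be both positive and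
  negative at \<open>z\<close>.\<close>

lemma extend_functional_indiff:
  assumes skew: "\<And>p q. g p \<bullet> q = - (g q \<bullet> p)"
    and G: "z \<in> G" "z \<in> Delta" "\<And>q. q \<in> Delta \<Longrightarrow> \<exists>d>0. \<forall>t. 0 < t \<longrightarrow> t < d \<longrightarrow> mix t z q \<in> G"
    and ag: "\<And>p. p \<in> G \<Longrightarrow> functional_at (g p) p"
    and D: "p \<in> Delta" "q \<in> Delta" and pq: "indiff S p q"
  shows "g p \<bullet> q \<le> 0"
proof (rule ccontr)
  assume b: "\<not> g p \<bullet> q \<le> 0"
  define m where "m = mix (1/2) q p"
  have mD: "m \<in> Delta" using D by (auto simp: m_def intro: mix_in_Delta)
  have self: "g p \<bullet> p = 0" "g q \<bullet> q = 0" using skew[of p p] skew[of q q] by auto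
  have bq: "0 < g m \<bullet> q" and bp: "g m \<bullet> p < 0"
    using b self skew[of m q] skew[of m p] skew[of q p] by (auto simp: m_def inner_mix)
  have "indiff S p m" "indiff S m q"
    using indiff_segment[OF D pq, of 0 "1/2"] indiff_segment[OF D pq, of "1/2" 1]
    by (auto simp: m_def mix_def)
  obtain d1 where d1: "d1 > 0" "\<And>t. 0 < t \<Longrightarrow> t < d1 \<Longrightarrow> mix t z q \<in> G" using G D by meson
  obtain d2 where d2: "d2 > 0" "\<And>t. 0 < t \<Longrightarrow> t < d2 \<Longrightarrow> mix t z p \<in> G" using G D by meson
  obtain d3 where d3: "d3 > 0"
      "\<And>t. 0 < t \<Longrightarrow> t < d3 \<Longrightarrow> 0 < t * (g m \<bullet> z) + (1 - t) * (g m \<bullet> q)"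
    using positive_mix_near[OF bq, of "g m \<bullet> z"] by blast
  obtain d4 where d4: "d4 > 0"
      "\<And>t. 0 < t \<Longrightarrow> t < d4 \<Longrightarrow> 0 < t * (- (g m \<bullet> z)) + (1 - t) * (- (g m \<bullet> p))"
    using positive_mix_near[of "- (g m \<bullet> p)" "- (g m \<bullet> z)"] bp by auto
  have "0 < min (min d1 d2) (min d3 d4)" using d1(1) d2(1) d3(1) d4(1) by simp
  from dense[OF this] obtain t where "0 < t" "t < min (min d1 d2) (min d3 d4)" by blast
  then have t0: "0 < t" "t < d1" "t < d2" "t < d3" "t < d4"
    unfolding min_less_iff_conj by blast+
  have "0 < t * (g m \<bullet> z) + (1 - t) * (g m \<bullet> q)" "t * (g m \<bullet> z) + (1 - t) * (g m \<bullet> p) < 0"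
    using d3(2)[OF t0(1,4)] d4(2)[OF t0(1,5)] by simp_all
  then have "g (mix t z q) \<bullet> m < 0" "0 < g (mix t z p) \<bullet> m"
    using skew[of m "mix t z q"] skew[of m "mix t z p"] by (simp_all add: inner_mix)
  then have st: "(m, mix t z q) \<in> S" "(mix t z p, m) \<in> S"
    using ag[OF d1(2)[OF t0(1,2)]] ag[OF d2(2)[OF t0(1,3)]] mD by (auto simp: functional_at_def)
  then obtain v where v: "functional_at v m" using functional_exists by blast
  have "v \<bullet> q = 0" "v \<bullet> p = 0"
    using functional_at_indiff[OF v] D \<open>indiff S p m\<close> \<open>indiff S m q\<close> indiff_sym by blast+
  moreover have "0 < v \<bullet> mix t z q" "v \<bullet> mix t z p < 0"
    using v st in_Delta by (auto simp: functional_at_def)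
  ultimately show False using t0 by (simp add: inner_mix zero_less_mult_iff mult_less_0_iff)
qed

theorem ssb_matrix_exists: "\<exists>M. ssb_matrix M S"
proof (cases "S = {}")
  case True
  then have "ssb_matrix (\<lambda>_ _. 0) S" by (simp add: ssb_matrix_def bil_def)
  then show ?thesis by blast
next
  case False
  then obtain p0 q0 where 0: "(p0, q0) \<in> S" by auto
  obtain b :: "real ^ 'a" where b: "b \<in> Delta_pos" using Delta_pos_nonempty by blast
  have bD: "b \<in> Delta" using b Delta_pos_Delta by blast
  \<comment> \<open>The strictly ranked pair is pushed into the interior: \<open>x\<close> becomes
    the base point against which functionals are scaled, and \<open>y\<close> witnesses that some
    interior point is strictly comparable to it.\<close>
  obtain d where d: "d > 0" "d \<le> 1" "\<And>t. 0 \<le> t \<Longrightarrow> t < d \<Longrightarrow> (p0, mix t b q0) \<in> S"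
    using open_lower_mix[OF 0 bD] by blast
  define x where "x = mix (d / 2) b q0"
  have x: "x \<in> Delta_pos" unfolding x_def using b d in_Delta[OF 0] by (intro mix_Delta_pos) auto
  have xD: "x \<in> Delta" using x Delta_pos_Delta by blast
  have px: "(p0, x) \<in> S" unfolding x_def using d by simp
  obtain d' where d': "d' > 0" "d' \<le> 1" "\<And>t. 0 \<le> t \<Longrightarrow> t < d' \<Longrightarrow> (mix t b p0, x) \<in> S"
    using open_upper_mix[OF px bD] by blast
  define y where "y = mix (d' / 2) b p0"
  have y: "y \<in> Delta_pos" unfolding y_def using b d' in_Delta[OF 0] by (intro mix_Delta_pos) auto
  have yx: "(y, x) \<in> S" unfolding y_def using d' by simp
  define V where "V p = (SOME v. functional_at v p)" for p
  have V: "functional_at (V p) p" if "p \<in> Delta_pos" for p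
    unfolding V_def using functional_interior[OF that] by (rule someI_ex)
  define G where "G = {p \<in> Delta_pos. \<not> indiff S x p}"
  have GD: "p \<in> Delta" if "p \<in> G" for p using that Delta_pos_Delta by (auto simp: G_def)
  have yG: "y \<in> G" using y yx by (auto simp: G_def indiff_def)
  have Gx: "V x \<bullet> p \<noteq> 0" if "p \<in> G" for p
    using that functional_at_indiff[OF V[OF x]] GD[OF that] by (auto simp: G_def)
  have near: "\<exists>d>0. \<forall>t. 0 < t \<longrightarrow> t < d \<longrightarrow> mix t z q \<in> G" if z: "z \<in> G" and q: "q \<in> Delta" for z q
  proof -
    have "\<exists>d>0. d \<le> 1 \<and> (\<forall>t. 0 < t \<longrightarrow> t < d \<longrightarrow> \<not> indiff S x (mix t z q))"
    proof (cases "indiff S x q")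
      case True
      then have "V x \<bullet> q = 0" using functional_at_indiff[OF V[OF x] q] by simp
      then have "\<not> indiff S x (mix t z q)" if "0 < t" "t < 1" for t
        using that functional_at_indiff[OF V[OF x], of "mix t z q"] Gx[OF z] q GD[OF z]
        by (simp add: inner_mix mix_in_Delta)
      then show ?thesis by (intro exI[of _ 1]) auto
    next
      case False
      then have "(x, q) \<in> S \<or> (q, x) \<in> S" by (auto simp: indiff_def)
      then obtain d where "d > 0" "d \<le> 1"
          "\<And>t. 0 \<le> t \<Longrightarrow> t < d \<Longrightarrow> (x, mix t z q) \<in> S \<or> (mix t z q, x) \<in> S"
        using open_lower_mix[OF _ GD[OF z]] open_upper_mix[OF _ GD[OF z]] by meson
      then show ?thesis by (intro exI[of _ d]) (auto simp: indiff_def)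
    qed
    then show ?thesis using mix_Delta_pos[of z q] z q by (fastforce simp: G_def)
  qed
  have span: "v \<in> span G" for v
  proof (rule span_pure)
    fix a
    obtain d where d: "d > 0" "\<And>t. 0 < t \<Longrightarrow> t < d \<Longrightarrow> mix t y (pure a) \<in> G"
      using near[OF yG pure_Delta] by blast
    define t where "t = min d 1 / 2"
    have t: "0 < t" "t < d" "t < 1" using d by (auto simp: t_def)
    have "(1 - t) *\<^sub>R pure a = mix t y (pure a) - t *\<^sub>R y" by (simp add: mix_def)
    also have "\<dots> \<in> span G" using d(2)[OF t(1,2)] yG by (intro span_diff span_scale) (auto intro: span_base)
    finally have "(1 / (1 - t)) *\<^sub>R ((1 - t) *\<^sub>R pure a) \<in> span G" by (rule span_scale)
    then show "pure a \<in> span G" using t by simp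
  qed
  \<comment> \<open>This factor makes \<open>F p \<bullet> x = - (V x \<bullet> p)\<close>. Skewness
    against the base point is thus built in, and the cocycle identity for \<open>x\<close>,
    \<open>p\<close>, \<open>q\<close> transfers it to strictly ranked \<open>p\<close>,
    \<open>q\<close> in \<open>G\<close>.\<close>
  define c where "c p = - (V x \<bullet> p) / (V p \<bullet> x)" for p
  define F where "F p = c p *\<^sub>R V p" for p
  have c: "c p > 0" if "p \<in> G" for p
    using functional_at_swap[OF V[OF x] V xD GD[OF that]] Gx[OF that] that
    by (auto simp: c_def G_def divide_pos_neg divide_neg_pos)
  have FG: "functional_at (F p) p" if "p \<in> G" for p
    unfolding F_def using c[OF that] V that by (auto simp: G_def intro: functional_at_scale)
  have skew: "F p \<bullet> q = - (F q \<bullet> p)" if p: "p \<in> G" and q: "q \<in> G" for p q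
  proof (cases "indiff S p q")
    case True
    then show ?thesis
      using functional_at_indiff FG p q GD indiff_sym by (metis minus_zero)
  next
    case False
    have P: "p \<in> Delta_pos" "q \<in> Delta_pos" using p q by (auto simp: G_def)
    note sw = functional_at_swap[OF V[OF x] V[OF P(1)] xD GD[OF p]]
      functional_at_swap[OF V[OF x] V[OF P(2)] xD GD[OF q]]
    have nz: "V x \<bullet> p \<noteq> 0" "V p \<bullet> q \<noteq> 0" "V q \<bullet> x \<noteq> 0" "V p \<bullet> x \<noteq> 0"
      using Gx p q sw False functional_at_indiff[OF V[OF P(1)] GD[OF q]] by auto
    have "(V x \<bullet> p) * (V p \<bullet> q) * (V q \<bullet> x) = - ((V p \<bullet> x) * (V q \<bullet> p) * (V x \<bullet> q))"
      using cocycle[OF x P nz(1-3) V[OF x] V[OF P(1)] V[OF P(2)]] .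
    then show ?thesis using nz by (simp add: F_def c_def field_simps)
  qed
  obtain g where g: "linear g" "\<And>p. p \<in> G \<Longrightarrow> g p = F p" "\<And>p q. g p \<bullet> q = - (g q \<bullet> p)"
    using skew_linear_extension[OF span skew] by blast
  have ag: "functional_at (g p) p" if "p \<in> G" for p using g(2)[OF that] FG[OF that] by simp
  have iff: "(p, q) \<in> S \<longleftrightarrow> 0 < g p \<bullet> q" if "p \<in> Delta" "q \<in> Delta" for p q
  proof -
    have "0 < g p \<bullet> q" if "(p, q) \<in> S" for p q
      using extend_functional_strict[OF g(3) yG GD[OF yG] near[OF yG] ag that] .
    moreover have "g p \<bullet> q \<le> 0" if "indiff S p q"
      using extend_functional_indiff[OF g(3) yG GD[OF yG] near[OF yG] ag \<open>p \<in> Delta\<close> \<open>q \<in> Delta\<close> that] .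
    ultimately show ?thesis
      using g(3)[of p q] trichotomy[of p q] by (metis less_asym neg_0_less_iff_less not_less)
  qed
  define M where "M a b = g (pure a) \<bullet> pure b" for a b
  have "(p, q) \<in> S \<longleftrightarrow> 0 < bil M p q" if "p \<in> Delta" "q \<in> Delta" for p q
    unfolding M_def bil_linear_form[OF g(1)] by (rule iff[OF that])
  moreover have "S \<subseteq> Delta \<times> Delta" using S by (simp add: prefs_def preference_def)
  moreover have "M a b = - M b a" for a b unfolding M_def by (rule g(3))
  ultimately have "ssb_matrix M S" unfolding ssb_matrix_def by blast
  then show ?thesis by blast
qed

end

section \<open>Bilinear forms, permutations and faces of the simplex\<close>

lemma bil_mix_left: "bil M (mix l p q) r = l * bil M p r + (1 - l) * bil M q r"
  by (simp add: bil_def mix_def algebra_simps sum.distrib sum_subtractf flip: sum_distrib_left)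

lemma bil_skew:
  assumes "\<And>a b. M a b = - M b a"
  shows "bil M p q = - bil M q p"
proof -
  have "bil M p q = (\<Sum>b\<in>UNIV. \<Sum>a\<in>UNIV. M a b * p $ a * q $ b)"
    unfolding bil_def by (rule sum.swap)
  also have "\<dots> = (\<Sum>b\<in>UNIV. \<Sum>a\<in>UNIV. - (M b a * q $ b * p $ a))"
    by (intro sum.cong refl) (subst assms, simp add: mult_ac)
  finally show ?thesis by (simp add: bil_def sum_negf)
qed

lemma bil_uminus: "bil (\<lambda>a b. - M a b) p q = - bil M p q"
  by (simp add: bil_def sum_negf)

lemma bil_mix_right: "bil M r (mix l p q) = l * bil M r p + (1 - l) * bil M r q"
  by (simp add: bil_def mix_def algebra_simps sum.distrib sum_subtractf flip: sum_distrib_left)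

lemma bil_pure: "bil (M :: 'a::finite \<Rightarrow> 'a \<Rightarrow> real) (pure a) (pure b) = M a b"
proof -
  have "pure x $ y = of_bool (y = x)" for x y :: 'a by (simp add: pure_def axis_def)
  then have "bil M (pure a) (pure b) = (\<Sum>x\<in>UNIV. \<Sum>y\<in>UNIV. M x y * of_bool (x = a) * of_bool (y = b))"
    by (simp add: bil_def)
  moreover have "(\<Sum>y\<in>UNIV. M x y * of_bool (x = a) * of_bool (y = b)) = M x b * of_bool (x = a)" for x
    by (subst sum_mult_of_bool_eq) auto
  ultimately show ?thesis by (simp add: sum_mult_of_bool_eq)
qed

lemma bil_le:
  assumes "\<And>a b. M a b \<le> k" "p \<in> Delta" "q \<in> Delta"
  shows "bil M p q \<le> k"
proof -
  have "bil M p q \<le> (\<Sum>a\<in>UNIV. \<Sum>b\<in>UNIV. k * p $ a * q $ b)"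
    unfolding bil_def using assms
    by (intro sum_mono mult_right_mono) (auto simp: Delta_def)
  also have "\<dots> = k" using assms by (simp add: sum_Delta flip: sum_distrib_left)
  finally show ?thesis .
qed

lemma ssb_matrixD:
  assumes "ssb_matrix M S"
  shows "M a b = - M b a" "p \<in> Delta \<Longrightarrow> q \<in> Delta \<Longrightarrow> (p, q) \<in> S \<longleftrightarrow> 0 < bil M p q"
    "(pure a, pure b) \<in> S \<longleftrightarrow> 0 < M a b" "S \<subseteq> Delta \<times> Delta" "bil M p q = - bil M q p" "M a a = 0"
proof -
  show 1: "M a b = - M b a" for a b using assms unfolding ssb_matrix_def by blast
  show 2: "(p, q) \<in> S \<longleftrightarrow> 0 < bil M p q" if "p \<in> Delta" "q \<in> Delta" for p q
    using assms that unfolding ssb_matrix_def by blast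
  show "(pure a, pure b) \<in> S \<longleftrightarrow> 0 < M a b" using 2[OF pure_Delta pure_Delta] by (simp add: bil_pure)
  show "S \<subseteq> Delta \<times> Delta" using assms unfolding ssb_matrix_def by blast
  show "bil M p q = - bil M q p" using bil_skew 1 .
  show "M a a = 0" using 1[of a a] by simp
qed

lemma ssb_matrix_indiff:
  assumes "ssb_matrix M S" "p \<in> Delta" "q \<in> Delta"
  shows "indiff S p q \<longleftrightarrow> bil M p q = 0"
  using ssb_matrixD(2)[OF assms] ssb_matrixD(2)[OF assms(1,3,2)] ssb_matrixD(5)[OF assms(1), of p q]
  by (auto simp: indiff_def)

lemma ssb_matrix_converse:
  assumes "ssb_matrix M S"
  shows "ssb_matrix (\<lambda>a b. - M a b) (S\<inverse>)"
  unfolding ssb_matrix_def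
proof (intro conjI allI ballI)
  show "- M a b = - (- M b a)" for a b using ssb_matrixD(1)[OF assms, of a b] by simp
  show "S\<inverse> \<subseteq> Delta \<times> Delta" using ssb_matrixD(4)[OF assms] by auto
  show "(p, q) \<in> S\<inverse> \<longleftrightarrow> 0 < bil (\<lambda>a b. - M a b) p q" if "p \<in> Delta" "q \<in> Delta" for p q
    using ssb_matrixD(2)[OF assms that(2,1)] ssb_matrixD(5)[OF assms, of p q] by (simp add: bil_uminus)
qed

text \<open>Stated for involutions, since it will be applied to transpositions; with
  \<open>inv \<pi> = \<pi>\<close> the same map acts on outcomes and on indices.\<close>

lemma ssb_matrix_perm:
  fixes \<pi> :: "'a::finite \<Rightarrow> 'a"
  assumes M: "ssb_matrix M S" and inv: "\<And>x. \<pi> (\<pi> x) = x"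
  shows "ssb_matrix (\<lambda>a b. M (\<pi> a) (\<pi> b)) (perm_pref \<pi> S)"
proof -
  have "inv \<pi> = \<pi>" using inv by (intro inv_equality) auto
  then have out: "perm_outcome \<pi> p = (\<chi> b. p $ \<pi> b)" for p by (simp add: perm_outcome_def)
  have bij: "bij \<pi>" using inv by (intro o_bij[of \<pi>]) (auto simp: fun_eq_iff)
  have reindex: "(\<Sum>a\<in>UNIV. h (\<pi> a)) = (\<Sum>a\<in>UNIV. h a)" for h :: "'a \<Rightarrow> real"
    using sum.reindex_bij_betw[of \<pi> UNIV UNIV h] bij by simp
  have idem: "perm_outcome \<pi> (perm_outcome \<pi> p) = p" for p by (simp add: out vec_eq_iff inv)
  have D: "perm_outcome \<pi> p \<in> Delta" if "p \<in> Delta" for p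
    using that reindex[of "($) p"] by (simp add: out Delta_def)
  have b: "bil (\<lambda>a b. M (\<pi> a) (\<pi> b)) p q = bil M (perm_outcome \<pi> p) (perm_outcome \<pi> q)" for p q
  proof -
    have "bil (\<lambda>a b. M (\<pi> a) (\<pi> b)) p q
        = (\<Sum>a\<in>UNIV. \<Sum>b\<in>UNIV. M (\<pi> a) (\<pi> b) * p $ \<pi> (\<pi> a) * q $ \<pi> (\<pi> b))"
      by (simp add: bil_def inv)
    also have "\<dots> = (\<Sum>a\<in>UNIV. \<Sum>b\<in>UNIV. M (\<pi> a) b * p $ \<pi> (\<pi> a) * q $ \<pi> b)"
      by (subst reindex[symmetric]) (rule refl)
    also have "\<dots> = (\<Sum>a\<in>UNIV. \<Sum>b\<in>UNIV. M a b * p $ \<pi> a * q $ \<pi> b)"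
      by (rule reindex)
    finally show ?thesis by (simp add: bil_def out)
  qed
  have mem: "(p, q) \<in> perm_pref \<pi> S \<longleftrightarrow> (perm_outcome \<pi> p, perm_outcome \<pi> q) \<in> S" for p q
    unfolding perm_pref_def using idem by (auto, metis)
  show ?thesis
    unfolding ssb_matrix_def
  proof (intro conjI allI ballI)
    show "M (\<pi> a) (\<pi> b) = - M (\<pi> b) (\<pi> a)" for a b by (rule ssb_matrixD(1)[OF M])
    show "perm_pref \<pi> S \<subseteq> Delta \<times> Delta"
      using ssb_matrixD(4)[OF M] D by (auto simp: perm_pref_def)
    show "(p, q) \<in> perm_pref \<pi> S \<longleftrightarrow> 0 < bil (\<lambda>a b. M (\<pi> a) (\<pi> b)) p q"
      if "p \<in> Delta" "q \<in> Delta" for p q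
      unfolding mem b using ssb_matrixD(2)[OF M D D] that by blast
  qed
qed

lemma Delta_on_outside: "p \<in> Delta_on X \<Longrightarrow> a \<notin> X \<Longrightarrow> p $ a = 0"
proof -
  assume p: "p \<in> Delta_on X" and a: "a \<notin> X"
  have "(\<Sum>a\<in>UNIV. p $ a) = (\<Sum>a\<in>X. p $ a) + (\<Sum>a\<in>-X. p $ a)"
    by (subst sum.union_disjoint[symmetric]) auto
  then have "(\<Sum>a\<in>-X. p $ a) = 0" using p by (simp add: Delta_on_def Delta_def)
  moreover have "0 \<le> p $ b" for b using p by (simp add: Delta_on_def Delta_def)
  ultimately show ?thesis using a by (simp add: sum_nonneg_eq_0_iff)
qed

lemma Delta_on_pair:
  assumes "p \<in> Delta_on {a, b}" "a \<noteq> b"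
  shows "p = mix (p $ a) (pure a) (pure b)"
proof -
  have "p $ a + p $ b = 1" using assms by (simp add: Delta_on_def)
  then show ?thesis
    using Delta_on_outside[OF assms(1)] assms(2)
    by (auto simp: vec_eq_iff mix_def pure_def axis_def)
qed

lemma Delta_on_Delta: "p \<in> Delta_on X \<Longrightarrow> p \<in> Delta"
  by (simp add: Delta_on_def)

lemma pure_Delta_on: "a \<in> X \<Longrightarrow> pure a \<in> Delta_on X"
  by (simp add: Delta_on_def pure_Delta) (simp add: pure_def axis_def)

lemma mix_Delta_on: "p \<in> Delta_on X \<Longrightarrow> q \<in> Delta_on X \<Longrightarrow> 0 \<le> l \<Longrightarrow> l \<le> 1 \<Longrightarrow> mix l p q \<in> Delta_on X"
  by (simp add: Delta_on_def mix_in_Delta) (simp add: mix_def sum.distrib flip: sum_distrib_left)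

lemma bil_pair:
  assumes "\<And>a b. M a b = - M b a" "p \<in> Delta_on {a, b}" "q \<in> Delta_on {a, b}" "a \<noteq> b"
  shows "bil M p q = (p $ a - q $ a) * M a b"
proof -
  have z: "M a a = 0" "M b b = 0" "M b a = - M a b" using assms(1)[of a a] assms(1)[of b b] assms(1)[of b a] by auto
  have "bil M (mix (p $ a) (pure a) (pure b)) (mix (q $ a) (pure a) (pure b)) = (p $ a - q $ a) * M a b"
    by (simp add: bil_mix_left bil_mix_right bil_pure z algebra_simps)
  then show ?thesis using Delta_on_pair[OF assms(2,4)] Delta_on_pair[OF assms(3,4)] by simp
qed

text \<open>On the segment between two pure outcomes the bilinear form is a multiple of a single
  entry. This is why IIA for two alternatives sees signs only.\<close>

lemma Restr_pair:
  assumes M: "ssb_matrix M S" and N: "ssb_matrix N T" and s: "sgn (M a b) = sgn (N a b)"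
    and ab: "a \<noteq> b"
  shows "Restr S (Delta_on {a, b}) = Restr T (Delta_on {a, b})"
proof -
  have "(p, q) \<in> S \<longleftrightarrow> (p, q) \<in> T" if p: "p \<in> Delta_on {a, b}" and q: "q \<in> Delta_on {a, b}" for p q
  proof -
    have "(p, q) \<in> S \<longleftrightarrow> 0 < (p $ a - q $ a) * M a b"
      using ssb_matrixD(2)[OF M Delta_on_Delta[OF p] Delta_on_Delta[OF q]]
        bil_pair[OF ssb_matrixD(1)[OF M] p q ab] by simp
    moreover have "(p, q) \<in> T \<longleftrightarrow> 0 < (p $ a - q $ a) * N a b"
      using ssb_matrixD(2)[OF N Delta_on_Delta[OF p] Delta_on_Delta[OF q]]
        bil_pair[OF ssb_matrixD(1)[OF N] p q ab] by simp
    moreover have "0 < x * M a b \<longleftrightarrow> 0 < x * N a b" for x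
      using s by (auto simp: zero_less_mult_iff sgn_if split: if_splits)
    ultimately show ?thesis by simp
  qed
  then show ?thesis by auto
qed

text \<open>\<open>A\<close> and \<open>B\<close> range freely over the nonnegative reals, so the zeros below form a line in the
  \<open>(A, B)\<close>-plane, and its slope is \<open>M a b / M c b\<close>.\<close>

lemma bil_odds:
  fixes A B :: real
  assumes sk: "\<And>a b. M a b = - M b a" and AB: "0 \<le> A" "0 \<le> B"
  shows "bil M (mix (1 / (1 + B)) (pure a) (pure b)) (mix (1 / (1 + A)) (pure c) (pure b)) =
    (M a c + A * M a b - B * M c b) / ((1 + A) * (1 + B))"
proof -
  have z: "M b b = 0" "M b c = - M c b" using sk[of b b] sk[of b c] by auto
  have nz: "1 + A \<noteq> 0" "1 + B \<noteq> 0" using AB by auto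
  have c: "1 - 1 / (1 + A) = A / (1 + A)" "1 - 1 / (1 + B) = B / (1 + B)"
    using nz by (auto simp: field_simps)
  show ?thesis unfolding bil_mix_left bil_mix_right bil_pure c z using nz by (simp add: divide_simps)
qed

text \<open>If \<open>M a b\<close> and \<open>M c b\<close> have opposite signs, some mixture of
  \<open>a\<close> and \<open>c\<close> is a zero against \<open>b\<close>. If they have the same
  sign there is no such mixture, and a mixture of \<open>a\<close> with \<open>b\<close> is compared
  with one of \<open>c\<close> with \<open>b\<close>.\<close>

lemma proportional_adjacent:
  assumes M: "\<And>a b. M a b = - M b a" and N: "\<And>a b. N a b = - N b a"
    and H: "\<And>p q. p \<in> Delta_on {a, b, c} \<Longrightarrow> q \<in> Delta_on {a, b, c} \<Longrightarrow> bil M p q = 0 \<Longrightarrow> bil N p q = 0"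
  shows "N a b * M c b = N c b * M a b"
proof -
  define x y where "x = M a b" and "y = M c b"
  have P: "pure a \<in> Delta_on {a, b, c}" "pure b \<in> Delta_on {a, b, c}" "pure c \<in> Delta_on {a, b, c}"
    by (auto intro: pure_Delta_on)
  have "x = 0 \<Longrightarrow> N a b = 0" "y = 0 \<Longrightarrow> N c b = 0"
    using H[OF P(1,2)] H[OF P(3,2)] by (auto simp: bil_pure x_def y_def)
  moreover have "N a b * y = N c b * x" if neg: "x * y < 0"
  proof -
    define l where "l = y / (y - x)"
    have nz: "y - x \<noteq> 0" using neg by (metis eq_iff_diff_eq_0 not_square_less_zero)
    have l: "0 \<le> l" "l \<le> 1" using neg nz by (auto simp: l_def mult_less_0_iff divide_simps)
    have lx: "(y - x) * l = y" "(y - x) * (1 - l) = - x" using nz by (auto simp: l_def field_simps)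
    have "(y - x) * (l * x + (1 - l) * y) = 0" unfolding distrib_left mult.assoc[symmetric] lx by simp
    then have "bil M (mix l (pure a) (pure c)) (pure b) = 0"
      using nz by (simp add: bil_mix_left bil_pure x_def y_def)
    then have "bil N (mix l (pure a) (pure c)) (pure b) = 0"
      using P l by (intro H mix_Delta_on) auto
    then have "(y - x) * (l * N a b + (1 - l) * N c b) = 0" by (simp add: bil_mix_left bil_pure)
    then show ?thesis unfolding distrib_left mult.assoc[symmetric] lx by (simp add: mult.commute)
  qed
  moreover have "N a b * y = N c b * x" if pos: "0 < x * y"
  proof -
    have nz: "x \<noteq> 0" "y \<noteq> 0" using pos by auto
    have zero: "N a c + A * N a b - B * N c b = 0"
      if "0 \<le> A" "0 \<le> B" "M a c + A * x - B * y = 0" for A B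
    proof -
      have "bil M (mix (1 / (1 + B)) (pure a) (pure b)) (mix (1 / (1 + A)) (pure c) (pure b)) = 0"
        using bil_odds[where M = M and a = a and b = b and c = c, OF M that(1,2)] that(3) by (simp add: x_def y_def)
      then have "bil N (mix (1 / (1 + B)) (pure a) (pure b)) (mix (1 / (1 + A)) (pure c) (pure b)) = 0"
        using P that by (intro H mix_Delta_on) auto
      then show ?thesis using bil_odds[where M = N and a = a and b = b and c = c, OF N that(1,2)] that by auto
    qed
    \<comment> \<open>\<open>A\<close> is large enough to make \<open>B\<close> nonnegative. Raising
      \<open>A\<close> by \<open>1\<close> and \<open>B\<close> by \<open>x / y\<close> stays on the
      line of zeros, and subtracting the two resulting equations for \<open>N\<close> leaves the
      ratio.\<close>
    define A where "A = \<bar>M a c / x\<bar>"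
    define B where "B = (M a c + A * x) / y"
    have "B = (M a c / x + A) * (x / y)" using nz by (simp add: B_def field_simps)
    moreover have "0 \<le> M a c / x + A" unfolding A_def by linarith
    moreover have xy: "0 < x / y" using pos by (simp add: zero_less_divide_iff zero_less_mult_iff)
    ultimately have B: "0 \<le> B" by (metis mult_nonneg_nonneg less_imp_le)
    have A: "0 \<le> A" by (simp add: A_def)
    have "N a c + A * N a b - B * N c b = 0" using A B nz by (intro zero) (auto simp: B_def)
    moreover have "N a c + (A + 1) * N a b - (B + x / y) * N c b = 0"
    proof (rule zero)
      show "0 \<le> A + 1" using A by simp
      show "0 \<le> B + x / y" using B xy by (intro add_nonneg_nonneg) auto
      show "M a c + (A + 1) * x - (B + x / y) * y = 0" using nz by (simp add: B_def field_simps)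
    qed
    ultimately have "N a b = x / y * N c b" by (simp add: algebra_simps)
    then show ?thesis using nz by simp
  qed
  ultimately have "N a b * y = N c b * x"
    by (metis linorder_neqE_linordered_idom mult_eq_0_iff mult_zero_left mult_zero_right)
  then show ?thesis by (simp add: x_def y_def)
qed

text \<open>In a mixture of \<open>a\<close> and \<open>d\<close> against the even mixture of
  \<open>b\<close> and \<open>c\<close> the cross terms vanish, and the weight
  \<open>y / (x + y)\<close> balances \<open>M a b\<close> against \<open>M c d\<close>.\<close>

lemma proportional_disjoint:
  assumes M: "\<And>a b. M a b = - M b a" and N: "\<And>a b. N a b = - N b a"
    and H: "\<And>p q. p \<in> Delta_on {a, b, c, d} \<Longrightarrow> q \<in> Delta_on {a, b, c, d} \<Longrightarrow> bil M p q = 0 \<Longrightarrow> bil N p q = 0"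
    and zero: "M a c = 0" "M d b = 0" and pos: "0 < M a b * M c d"
  shows "N a b * M c d = N c d * M a b"
proof -
  define x y where "x = M a b" and "y = M c d"
  have P: "pure a \<in> Delta_on {a, b, c, d}" "pure b \<in> Delta_on {a, b, c, d}"
    "pure c \<in> Delta_on {a, b, c, d}" "pure d \<in> Delta_on {a, b, c, d}"
    by (auto intro: pure_Delta_on)
  have zero': "N a c = 0" "N d b = 0"
    using H[OF P(1,3)] H[OF P(4,2)] zero by (simp_all add: bil_pure)
  define l where "l = y / (x + y)"
  have nz: "x + y \<noteq> 0" using pos by (auto simp: x_def y_def zero_less_mult_iff)
  have l: "0 \<le> l" "l \<le> 1" using pos by (auto simp: l_def x_def y_def zero_less_mult_iff divide_simps)
  have lx: "(x + y) * l = y" "(x + y) * (1 - l) = x" using nz by (auto simp: l_def field_simps)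
  have form: "2 * (x + y) * bil K (mix l (pure a) (pure d)) (mix (1/2) (pure b) (pure c)) = y * K a b - x * K c d"
    if "K a c = 0" "K d b = 0" "K d c = - K c d" for K
  proof -
    have "2 * (x + y) * bil K (mix l (pure a) (pure d)) (mix (1/2) (pure b) (pure c))
      = (x + y) * l * K a b + (x + y) * (1 - l) * (- K c d)"
      unfolding bil_mix_left bil_mix_right bil_pure that by (simp add: algebra_simps)
    then show ?thesis unfolding lx by simp
  qed
  have "bil M (mix l (pure a) (pure d)) (mix (1/2) (pure b) (pure c)) = 0"
    using form[of M, OF zero M] nz by (simp add: x_def y_def)
  then have "bil N (mix l (pure a) (pure d)) (mix (1/2) (pure b) (pure c)) = 0"
    using P l by (intro H mix_Delta_on) auto
  then show ?thesis using form[of N, OF zero' N] by (simp add: x_def y_def mult.commute)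
qed

section \<open>Aggregation\<close>

lemma opposite_sym:
  assumes "ssb_matrix M S" "ssb_matrix N T" "sgn (N a b) = - sgn (M a b)"
  shows "sgn (N b a) = - sgn (M b a)"
  using assms(3) ssb_matrixD(1)[OF assms(1), of a b] ssb_matrixD(1)[OF assms(2), of a b]
  by (simp add: sgn_minus)

locale anonymous_arrow =
  fixes n :: nat and D :: "('a::finite) pref set" and f :: "(nat \<Rightarrow> 'a pref) \<Rightarrow> 'a pref"
  assumes n: "n \<ge> 2" and card: "CARD('a) \<ge> 4" and rich: "rich D" and swf: "swf n D f"
    and arrovian: "arrovian n D f" and anonymous: "anonymous n D f"
begin

definition pair :: "'a pref \<Rightarrow> 'a pref \<Rightarrow> nat \<Rightarrow> 'a pref" where
  "pair S T = (\<lambda>i\<in>{1..n}. if i = 1 then S else if i = 2 then T else {})"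

definition g :: "'a pref \<Rightarrow> 'a pref \<Rightarrow> 'a pref" where
  "g S T = f (pair S T)"

lemma D_prefs: "S \<in> D \<Longrightarrow> S \<in> prefs"
  using rich[unfolded rich_def, THEN conjunct1] by blast

lemma D_converse: "S \<in> D \<Longrightarrow> S\<inverse> \<in> D"
  using rich[unfolded rich_def, THEN conjunct2, THEN conjunct2, THEN conjunct2, THEN conjunct1] by blast

lemma D_perm: "S \<in> D \<Longrightarrow> \<pi> permutes UNIV \<Longrightarrow> perm_pref \<pi> S \<in> D"
  using rich[unfolded rich_def, THEN conjunct2, THEN conjunct1] D_prefs by blast

lemma D_bottom:
  assumes "S \<in> D" "X \<subset> UNIV" "card X \<le> 4"
  obtains T a where "T \<in> D" "Restr T (pure ` X) = Restr S (pure ` X)"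
    "\<And>x. x \<in> X \<Longrightarrow> (pure x, pure a) \<in> T"
proof -
  have "\<exists>T\<in>D. \<exists>a. Restr T (pure ` X) = Restr S (pure ` X) \<and> (\<forall>x\<in>X. (pure x, pure a) \<in> T)"
    by (rule rich[unfolded rich_def, THEN conjunct2, THEN conjunct2, THEN conjunct2, THEN conjunct2, rule_format,
          OF assms(1)]) (use assms in simp)
  then show ?thesis using that by blast
qed

lemma matrix: "S \<in> prefs \<Longrightarrow> \<exists>M. ssb_matrix M S"
  by (rule convex_pref.ssb_matrix_exists) (simp add: convex_pref_def)

lemma pair_profile: "S \<in> D \<Longrightarrow> T \<in> D \<Longrightarrow> pair S T \<in> profiles n D"
  using rich by (auto simp: pair_def profiles_def rich_def)

lemma g_prefs: "S \<in> D \<Longrightarrow> T \<in> D \<Longrightarrow> g S T \<in> prefs"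
  using swf pair_profile by (auto simp: g_def swf_def)

lemma g_sym:
  assumes "S \<in> D" "T \<in> D"
  shows "g S T = g T S"
proof -
  define \<pi> where "\<pi> = Transposition.transpose (1::nat) 2"
  have p: "\<pi> permutes {1..n}" using n by (auto simp: \<pi>_def intro: permutes_swap_id)
  have "pair T S = pair S T \<circ> \<pi>"
  proof
    fix i
    have "i \<notin> {1..n} \<Longrightarrow> \<pi> i = i" using p by (simp add: permutes_def)
    then show "pair T S i = (pair S T \<circ> \<pi>) i"
      using n by (auto simp: pair_def \<pi>_def Transposition.transpose_def)
  qed
  then show ?thesis
    using anonymous p pair_profile[OF assms] by (auto simp: anonymous_def g_def)
qed

lemma pair_cases:
  assumes "i \<in> {1..n}"
  shows "pair S T i = S \<or> pair S T i = T \<or> pair S T i = {}"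
  using assms by (simp add: pair_def)

lemma g_pareto:
  assumes "S \<in> D" "T \<in> D" "p \<in> Delta" "q \<in> Delta" "weakly S p q" "weakly T p q"
  shows "weakly (g S T) p q" "(p, q) \<in> S \<or> (p, q) \<in> T \<Longrightarrow> (p, q) \<in> g S T"
proof -
  have w: "\<forall>i\<in>{1..n}. weakly (pair S T i) p q"
  proof
    fix i assume "i \<in> {1..n}"
    then show "weakly (pair S T i) p q"
      using pair_cases[of i S T] assms(5,6) by (auto simp: weakly_def indiff_def)
  qed
  have "pareto n D f" using arrovian by (simp add: arrovian_def)
  then have P: "weakly (g S T) p q \<and> ((\<exists>i\<in>{1..n}. (p, q) \<in> pair S T i) \<longrightarrow> (p, q) \<in> g S T)"
    using assms(3,4) pair_profile[OF assms(1,2)] w unfolding pareto_def g_def by blast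
  then show "weakly (g S T) p q" by blast
  have "pair S T 1 = S" "pair S T 2 = T" "1 \<in> {1..n}" "2 \<in> {1..n}" using n by (auto simp: pair_def)
  then have "\<exists>i\<in>{1..n}. (p, q) \<in> pair S T i" if "(p, q) \<in> S \<or> (p, q) \<in> T"
    using that by (elim disjE) (rule bexI[of _ 1] bexI[of _ 2]; simp)+
  then show "(p, q) \<in> S \<or> (p, q) \<in> T \<Longrightarrow> (p, q) \<in> g S T" using P by blast
qed

lemma g_indiff:
  assumes "S \<in> D" "T \<in> D" "p \<in> Delta" "q \<in> Delta" "indiff S p q" "indiff T p q"
  shows "indiff (g S T) p q"
proof -
  have "weakly (g S T) p q" "weakly (g S T) q p"
    using g_pareto(1)[OF assms(1-4)] g_pareto(1)[OF assms(1,2,4,3)] assms(5,6)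
    by (auto simp: weakly_def indiff_sym[of S q] indiff_sym[of T q])
  moreover have "convex_pref (g S T)" using g_prefs assms(1,2) by (simp add: convex_pref_def)
  ultimately show ?thesis using convex_pref.not_sym[of "g S T" p q] by (auto simp: weakly_def indiff_def)
qed

lemma g_iia:
  assumes "S \<in> D" "T \<in> D" "S' \<in> D" "T' \<in> D" "a \<noteq> b"
    and M: "ssb_matrix M S" "ssb_matrix N T" "ssb_matrix M' S'" "ssb_matrix N' T'"
    and G: "ssb_matrix G (g S T)" "ssb_matrix G' (g S' T')"
    and s: "sgn (M a b) = sgn (M' a b)" "sgn (N a b) = sgn (N' a b)"
  shows "sgn (G a b) = sgn (G' a b)"
proof -
  let ?X = "Delta_on {a, b}"
  have "Restr S ?X = Restr S' ?X" "Restr T ?X = Restr T' ?X"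
    using Restr_pair[OF M(1,3) s(1) assms(5)] Restr_pair[OF M(2,4) s(2) assms(5)] by auto
  then have "\<forall>i\<in>{1..n}. Restr (pair S T i) ?X = Restr (pair S' T' i) ?X"
    by (simp add: pair_def)
  then have R: "Restr (g S T) ?X = Restr (g S' T') ?X"
    using arrovian pair_profile assms(1-4) unfolding arrovian_def iia_def g_def by blast
  have P: "pure a \<in> ?X" "pure b \<in> ?X" by (auto intro: pure_Delta_on)
  have "(pure a, pure b) \<in> g S T \<longleftrightarrow> (pure a, pure b) \<in> g S' T'"
    "(pure b, pure a) \<in> g S T \<longleftrightarrow> (pure b, pure a) \<in> g S' T'"
    using R P by blast+
  then have "0 < G a b \<longleftrightarrow> 0 < G' a b" "0 < G b a \<longleftrightarrow> 0 < G' b a"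
    using ssb_matrixD(3)[OF G(1)] ssb_matrixD(3)[OF G(2)] by auto
  then show ?thesis
    using ssb_matrixD(1)[OF G(1), of b a] ssb_matrixD(1)[OF G(2), of b a] by (auto simp: sgn_if)
qed

text \<open>Richness preserves comparisons of pure outcomes only, so the new matrix inherits signs
  on \<open>X\<close> but no sizes.\<close>

lemma strict_chain:
  assumes "S \<in> D" "ssb_matrix M S" "X \<subset> UNIV" "card X \<le> 4"
  obtains T N d where "T \<in> D" "ssb_matrix N T" "\<And>x y. x \<in> X \<Longrightarrow> y \<in> X \<Longrightarrow> sgn (N x y) = sgn (M x y)"
    "\<And>x. x \<in> X \<Longrightarrow> 0 < N x d" "d \<notin> X"
proof -
  obtain T d where T: "T \<in> D" "Restr T (pure ` X) = Restr S (pure ` X)"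
    "\<And>x. x \<in> X \<Longrightarrow> (pure x, pure d) \<in> T"
    using D_bottom[OF assms(1,3,4)] by blast
  obtain N where N: "ssb_matrix N T" using matrix D_prefs T(1) by blast
  have pos: "0 < N x d" if "x \<in> X" for x using T(3)[OF that] ssb_matrixD(3)[OF N] by simp
  have "sgn (N x y) = sgn (M x y)" if "x \<in> X" "y \<in> X" for x y
  proof -
    have "(pure x, pure y) \<in> T \<longleftrightarrow> (pure x, pure y) \<in> S" "(pure y, pure x) \<in> T \<longleftrightarrow> (pure y, pure x) \<in> S"
      using T(2) that by blast+
    then have "0 < N x y \<longleftrightarrow> 0 < M x y" "0 < N y x \<longleftrightarrow> 0 < M y x"
      using ssb_matrixD(3)[OF N] ssb_matrixD(3)[OF assms(2)] by auto
    then show ?thesis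
      using ssb_matrixD(1)[OF N, of y x] ssb_matrixD(1)[OF assms(2), of y x] by (auto simp: sgn_if)
  qed
  moreover have "d \<notin> X" using pos ssb_matrixD(6)[OF N] by force
  ultimately show ?thesis using that T(1) N pos by blast
qed

lemma swap_matrix:
  fixes a c :: 'a
  assumes "S \<in> D" "ssb_matrix M S"
  defines "\<tau> \<equiv> Transposition.transpose a c"
  shows "perm_pref \<tau> S \<in> D" "ssb_matrix (\<lambda>x y. M (\<tau> x) (\<tau> y)) (perm_pref \<tau> S)"
proof -
  show "perm_pref \<tau> S \<in> D" unfolding \<tau>_def by (intro D_perm assms(1) permutes_swap_id) auto
  show "ssb_matrix (\<lambda>x y. M (\<tau> x) (\<tau> y)) (perm_pref \<tau> S)"
    by (rule ssb_matrix_perm[OF assms(2)]) (simp add: \<tau>_def)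
qed

text \<open>For \<open>S\<close> against its inverse, indifference of one is indifference of both,
  so Pareto optimality makes every zero of \<open>M\<close> a zero of \<open>G\<close>.\<close>

lemma adjacent_sign:
  assumes S: "S \<in> D" and M: "ssb_matrix M S" and G: "ssb_matrix G (g S (S\<inverse>))"
  shows "sgn (G a b) * sgn (M c b) = sgn (G c b) * sgn (M a b)"
proof -
  have H: "bil G p q = 0" if "p \<in> Delta_on {a, b, c}" "q \<in> Delta_on {a, b, c}" "bil M p q = 0" for p q
  proof -
    have D: "p \<in> Delta" "q \<in> Delta" using that Delta_on_Delta by auto
    have "indiff S p q" using ssb_matrix_indiff[OF M D] that by simp
    then have "indiff (g S (S\<inverse>)) p q"
      using S D_converse D by (intro g_indiff) (auto simp: indiff_converse)
    then show ?thesis using ssb_matrix_indiff[OF G D] by simp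
  qed
  have "G a b * M c b = G c b * M a b"
    using proportional_adjacent[where M = M and N = G and a = a and b = b and c = c,
        OF ssb_matrixD(1)[OF M] ssb_matrixD(1)[OF G] H]
    by blast
  then show ?thesis unfolding sgn_mult[symmetric] by (rule arg_cong)
qed

text \<open>If \<open>a\<close> and \<open>b\<close> are ranked oppositely, the outcome depends neither on who ranks \<open>a\<close> higher
  nor on the rest. Under \<open>a > b > c\<close> against its inverse the social preference ranks \<open>a, b\<close> like
  \<open>b, c\<close>; under \<open>a > c > b\<close> against its inverse it ranks \<open>a, b\<close> like \<open>c, b\<close>.\<close>

lemma conflict_indiff:
  assumes S: "S \<in> D" and T: "T \<in> D" and M: "ssb_matrix M S" and N: "ssb_matrix N T"
    and G: "ssb_matrix G (g S T)" and ab: "0 < M a b" "N a b < 0"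
  shows "G a b = 0"
proof -
  have nab: "a \<noteq> b" using ab ssb_matrixD(6)[OF M] by auto
  have c2: "card {a, b} \<le> 4" using nab by simp
  have sub: "{a, b} \<subset> (UNIV :: 'a set)"
  proof -
    have "card {a, b} < CARD('a)" using nab card by simp
    then show ?thesis by (metis psubsetI subset_UNIV less_irrefl)
  qed
  obtain S1 M1 c where S1: "S1 \<in> D" "ssb_matrix M1 S1"
      "\<And>x y. x \<in> {a, b} \<Longrightarrow> y \<in> {a, b} \<Longrightarrow> sgn (M1 x y) = sgn (M x y)"
      "\<And>x. x \<in> {a, b} \<Longrightarrow> 0 < M1 x c" "c \<notin> {a, b}"
    using strict_chain[OF S M sub c2] by blast
  have pos1: "0 < M1 a b" "0 < M1 b c" "0 < M1 a c"
    using S1(3)[of a b] S1(4) ab by (auto simp: sgn_if split: if_splits)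
  define \<tau> where "\<tau> = Transposition.transpose b c"
  define S2 where "S2 = perm_pref \<tau> S1"
  define M2 where "M2 = (\<lambda>x y. M1 (\<tau> x) (\<tau> y))"
  have S2: "S2 \<in> D" "ssb_matrix M2 S2"
    unfolding S2_def M2_def \<tau>_def using swap_matrix[OF S1(1,2)] by auto
  have tau: "\<tau> a = a" "\<tau> b = c" "\<tau> c = b" using nab S1(5) by (auto simp: \<tau>_def Transposition.transpose_def)
  have pos2: "0 < M2 a c" "0 < M2 c b" "0 < M2 a b" using pos1 by (auto simp: M2_def tau)
  have inv: "S1\<inverse> \<in> D" "S2\<inverse> \<in> D" using S1 S2 D_converse by auto
  note C1 = ssb_matrix_converse[OF S1(2)] and C2 = ssb_matrix_converse[OF S2(2)]
  obtain G1 where G1: "ssb_matrix G1 (g S1 (S1\<inverse>))" using matrix[OF g_prefs[OF S1(1) inv(1)]] by blast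
  obtain G2 where G2: "ssb_matrix G2 (g S2 (S2\<inverse>))" using matrix[OF g_prefs[OF S2(1) inv(2)]] by blast
  \<comment> \<open>Anonymity enters here: \<open>S1\<close> ranks \<open>b\<close> over
    \<open>c\<close> and \<open>S2\<close> ranks \<open>c\<close> over \<open>b\<close>, so on this
    pair the counterpart of \<open>S1\<close> is \<open>S2\<inverse>\<close>, and the agents must
    trade places.\<close>
  have G2': "ssb_matrix G2 (g (S2\<inverse>) S2)" using G2 g_sym[OF S2(1) inv(2)] by simp
  have sk: "M1 c b = - M1 b c" "M2 b c = - M2 c b" "G1 c b = - G1 b c" "G2 c b = - G2 b c"
    by (rule ssb_matrixD(1)[OF S1(2)], rule ssb_matrixD(1)[OF S2(2)],
        rule ssb_matrixD(1)[OF G1], rule ssb_matrixD(1)[OF G2])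
  have 1: "sgn (G1 a b) = sgn (G1 b c)"
    using adjacent_sign[OF S1(1,2) G1, of a b c] pos1 sk by (simp add: sgn_minus)
  have 2: "sgn (G2 a b) = - sgn (G2 b c)"
    using adjacent_sign[OF S2(1,2) G2, of a b c] pos2 sk by (simp add: sgn_minus)
  have bc: "b \<noteq> c" using S1(5) by auto
  have 4: "sgn (G1 b c) = sgn (G2 b c)"
    using pos1 pos2 sk
    by (intro g_iia[OF S1(1) inv(1) inv(2) S2(1) bc S1(2) C1 C2 S2(2) G1 G2']) auto
  have 5: "sgn (G1 a b) = sgn (G2 a b)"
    using pos1 pos2 by (intro g_iia[OF S1(1) inv(1) S2(1) inv(2) nab S1(2) C1 S2(2) C2 G1 G2]) auto
  have 6: "sgn (G a b) = sgn (G1 a b)"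
    using pos1 ab by (intro g_iia[OF S T S1(1) inv(1) nab M N S1(2) C1 G G1]) auto
  \<comment> \<open>\<open>G1 a b\<close>, \<open>G1 b c\<close> and \<open>G2 b c\<close> have the
    same sign, opposite to that of \<open>G2 a b\<close>; yet IIA gives \<open>G1 a b\<close> and
    \<open>G2 a b\<close> equal signs.\<close>
  have "sgn (G a b) = 0" using 1 2 4 5 6 by simp
  then show ?thesis by (simp add: sgn_0_0)
qed

text \<open>The social matrix vanishes on \<open>X\<close>, so society is indifferent on
  \<open>Delta_on X\<close>. If \<open>S\<close> were indifferent between \<open>p\<close> and
  \<open>q\<close> and \<open>T\<close> were not, Pareto optimality would make society
  strict.\<close>

lemma opposite_zero:
  assumes S: "S \<in> D" and T: "T \<in> D" and M: "ssb_matrix M S" and N: "ssb_matrix N T"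
    and opp: "\<And>a b. a \<in> X \<Longrightarrow> b \<in> X \<Longrightarrow> sgn (N a b) = - sgn (M a b)"
    and pq: "p \<in> Delta_on X" "q \<in> Delta_on X" "bil M p q = 0"
  shows "bil N p q = 0"
proof -
  obtain G where G: "ssb_matrix G (g S T)" using matrix[OF g_prefs[OF S T]] by blast
  have G0: "G a b = 0" if ab: "a \<in> X" "b \<in> X" for a b
  proof -
    consider "0 < M a b" | "M a b < 0" | "M a b = 0" by linarith
    then show ?thesis
    proof cases
      case 1
      then have "N a b < 0" using opp[OF ab] by (simp add: sgn_if split: if_splits)
      then show ?thesis using conflict_indiff[OF S T M N G 1] by simp
    next
      case 2
      then have "0 < M b a" using ssb_matrixD(1)[OF M, of b a] by simp
      moreover have "N b a < 0"
        using 2 opp[OF ab] ssb_matrixD(1)[OF N, of b a] by (simp add: sgn_if split: if_splits)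
      ultimately have "G b a = 0" using conflict_indiff[OF S T M N G] by blast
      then show ?thesis using ssb_matrixD(1)[OF G, of a b] by simp
    next
      case 3
      then have "N a b = 0" using opp[OF ab] by (simp add: sgn_0_0)
      then have "indiff (g S T) (pure a) (pure b)"
        using 3 ssb_matrix_indiff[OF M pure_Delta pure_Delta] ssb_matrix_indiff[OF N pure_Delta pure_Delta]
        by (intro g_indiff S T pure_Delta) (auto simp: bil_pure)
      then show ?thesis using ssb_matrix_indiff[OF G pure_Delta pure_Delta] by (simp add: bil_pure)
    qed
  qed
  have D: "p \<in> Delta" "q \<in> Delta" using pq Delta_on_Delta by auto
  have terms: "G a b * p $ a * q $ b = 0" for a b
    using G0 Delta_on_outside[OF pq(1), of a] Delta_on_outside[OF pq(2), of b]
    by (metis mult_zero_left mult_zero_right)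
  have "bil G p q = 0" by (simp only: bil_def terms sum.neutral_const)
  then have Gi: "indiff (g S T) p q" using ssb_matrix_indiff[OF G D] by simp
  have Si: "indiff S p q" using ssb_matrix_indiff[OF M D] pq by simp
  have "(p, q) \<notin> T"
    using g_pareto(2)[OF S T D] Si Gi by (auto simp: weakly_def indiff_def)
  moreover have "(q, p) \<notin> T"
    using g_pareto(2)[OF S T D(2,1)] Si Gi by (auto simp: weakly_def indiff_def)
  ultimately show ?thesis using ssb_matrix_indiff[OF N D] by (simp add: indiff_def)
qed

lemma opposite_triple:
  assumes S: "S \<in> D" and T: "T \<in> D" and M: "ssb_matrix M S" and N: "ssb_matrix N T"
    and opp: "sgn (N a b) = - sgn (M a b)" "sgn (N c b) = - sgn (M c b)" "sgn (N a c) = - sgn (M a c)"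
  shows "N a b * M c b = N c b * M a b"
proof (rule proportional_adjacent[where M = M and N = N,
      OF ssb_matrixD(1)[OF M] ssb_matrixD(1)[OF N]])
  note os = opposite_sym[OF M N]
  have "sgn (N x y) = - sgn (M x y)" if "x \<in> {a, b, c}" "y \<in> {a, b, c}" for x y
    using that opp os[OF opp(1)] os[OF opp(2)] os[OF opp(3)] ssb_matrixD(6)[OF M] ssb_matrixD(6)[OF N]
    by auto
  then show "bil N p q = 0"
    if "p \<in> Delta_on {a, b, c}" "q \<in> Delta_on {a, b, c}" "bil M p q = 0" for p q
    using opposite_zero[OF S T M N _ that] by blast
qed

section \<open>Equality of the nonzero matrix entries\<close>

lemma square_eq_abs: "x * x = y * y \<Longrightarrow> \<bar>x\<bar> = \<bar>y\<bar>" for x y :: real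
  by (simp add: square_eq_iff abs_eq_iff)

text \<open>Swapping \<open>a\<close> and \<open>c\<close> exchanges \<open>M a b\<close> with
  \<open>M c b\<close> and negates \<open>M a c\<close>. With \<open>b\<close> in the middle, the
  swapped preference is itself opposite to \<open>S\<close> on the triple; with
  \<open>M a c = 0\<close> and equal signs, its inverse is. Proportionality then equates the
  squares.\<close>

lemma abs_eq_middle:
  assumes S: "S \<in> D" and M: "ssb_matrix M S" and d: "a \<noteq> b" "b \<noteq> c" "a \<noteq> c"
    and p: "M a b * M c b < 0 \<or> M a c = 0 \<and> 0 < M a b * M c b"
  shows "\<bar>M a b\<bar> = \<bar>M c b\<bar>"
proof -
  define \<tau> where "\<tau> = Transposition.transpose a c"
  have tau: "\<tau> a = c" "\<tau> b = b" "\<tau> c = a" using d by (auto simp: \<tau>_def Transposition.transpose_def)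
  define T where "T = perm_pref \<tau> S"
  define N where "N = (\<lambda>x y. M (\<tau> x) (\<tau> y))"
  have T: "T \<in> D" "ssb_matrix N T" unfolding T_def N_def \<tau>_def using swap_matrix[OF S M] by auto
  have N: "N a b = M c b" "N c b = M a b" "N a c = - M a c"
    using ssb_matrixD(1)[OF M, of c a] by (auto simp: N_def tau)
  show ?thesis using p
  proof
    assume neg: "M a b * M c b < 0"
    have "N a b * M c b = N c b * M a b"
      using neg by (intro opposite_triple[OF S T(1) M T(2)])
        (auto simp: N sgn_minus mult_less_0_iff)
    then have "M a b * M a b = M c b * M c b" by (simp add: N)
    then show ?thesis by (rule square_eq_abs)
  next
    assume pos: "M a c = 0 \<and> 0 < M a b * M c b"
    have "- N a b * M c b = - N c b * M a b"
      using pos by (intro opposite_triple[OF S D_converse[OF T(1)] M ssb_matrix_converse[OF T(2)]])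
        (auto simp: N sgn_minus zero_less_mult_iff)
    then have "M a b * M a b = M c b * M c b" by (simp add: N)
    then show ?thesis by (rule square_eq_abs)
  qed
qed

text \<open>With an alternative \<open>d\<close> below \<open>w > u > v\<close>, each of the three values is linked to another through
  a triple in which the shared alternative is in the middle.\<close>

lemma eq_chain:
  assumes S: "S \<in> D" and M: "ssb_matrix M S" and pos: "0 < M w u" "0 < M u v" "0 < M w v"
  shows "M w u = M u v" "M w v = M u v"
proof -
  have ne: "w \<noteq> u" "u \<noteq> v" "w \<noteq> v" using pos ssb_matrixD(6)[OF M] by auto
  have c3: "card {w, u, v} = 3" using ne by simp
  have sub: "{w, u, v} \<subset> (UNIV :: 'a set)"
  proof -
    have "card {w, u, v} < CARD('a)" using c3 card by simp
    then show ?thesis by (metis psubsetI subset_UNIV less_irrefl)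
  qed
  obtain T N d where T: "T \<in> D" "ssb_matrix N T"
      "\<And>x y. x \<in> {w, u, v} \<Longrightarrow> y \<in> {w, u, v} \<Longrightarrow> sgn (N x y) = sgn (M x y)"
      "\<And>x. x \<in> {w, u, v} \<Longrightarrow> 0 < N x d" "d \<notin> {w, u, v}"
    using strict_chain[OF S M sub] c3 by auto
  have "sgn (N w u) = 1" "sgn (N u v) = 1" "sgn (N w v) = 1"
    using T(3)[of w u] T(3)[of u v] T(3)[of w v] pos by auto
  then have Np: "0 < N w u" "0 < N u v" "0 < N w v" by (auto simp: sgn_if split: if_splits)
  have Nd: "0 < N w d" "0 < N u d" "0 < N v d" using T(4) by auto
  have eq: "N x y = N y z" if "0 < N x y" "0 < N y z" "x \<noteq> z" for x y z
  proof -
    have ne: "x \<noteq> y" "y \<noteq> z" using that ssb_matrixD(6)[OF T(2)] by auto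
    have zy: "N z y = - N y z" by (rule ssb_matrixD(1)[OF T(2)])
    have "\<bar>N x y\<bar> = \<bar>N z y\<bar>"
      using that by (intro abs_eq_middle[OF T(1,2) ne that(3)]) (auto simp: zy mult_pos_neg)
    then show ?thesis using that zy by simp
  qed
  \<comment> \<open>\<open>N v d\<close> serves as the common value of \<open>N u v\<close> and
    \<open>N w v\<close>, which \<open>abs_eq_middle\<close> cannot link within \<open>w\<close>,
    \<open>u\<close>, \<open>v\<close>.\<close>
  have Nk: "N w u = N u v" "N w v = N u v"
    using eq[OF Np(1,2) ne(3)] eq[OF Np(2) Nd(3)] eq[OF Np(3) Nd(3)] T(5) by auto
  note C = D_converse[OF T(1)] and CN = ssb_matrix_converse[OF T(2)]
  have sgn: "sgn (- N x y) = - sgn (M x y)" if "x \<in> {w, u, v}" "y \<in> {w, u, v}" for x y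
    using T(3)[OF that] by (simp add: sgn_minus)
  \<comment> \<open>\<open>S\<close> and the inverse of \<open>T\<close> are opposite on the triple,
    so \<open>M\<close> is proportional to \<open>N\<close> there and inherits the equality of its
    entries.\<close>
  have "- N w u * M v u = - N v u * M w u"
    by (rule opposite_triple[OF S C M CN]) (rule sgn; simp)+
  then show "M w u = M u v"
    using Nk Np ssb_matrixD(1)[OF M, of v u] ssb_matrixD(1)[OF T(2), of v u] by simp
  have "- N w v * M u v = - N u v * M w v"
    by (rule opposite_triple[OF S C M CN]) (rule sgn; simp)+
  then show "M w v = M u v" using Nk Np by simp
qed

lemma abs_eq_adjacent:
  assumes S: "S \<in> D" and M: "ssb_matrix M S" and nz: "M a b \<noteq> 0" "M c b \<noteq> 0"
  shows "\<bar>M a b\<bar> = \<bar>M c b\<bar>"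
proof (cases "a = c")
  case False
  have ne: "a \<noteq> b" "b \<noteq> c" using nz ssb_matrixD(6)[OF M] by auto
  have sk: "M b a = - M a b" "M b c = - M c b" "M c a = - M a c" by (rule ssb_matrixD(1)[OF M])+
  show ?thesis
  proof (cases "M a b * M c b < 0 \<or> M a c = 0")
    case True
    then show ?thesis
      using nz by (intro abs_eq_middle[OF S M ne False]) (auto simp: not_less order_less_le)
  next
    case F: False
    then have same: "0 < M a b * M c b" using nz by (simp add: order_less_le not_less)
    consider "0 < M a b" "0 < M c b" "0 < M a c" | "0 < M a b" "0 < M c b" "0 < M c a"
      | "0 < M b a" "0 < M b c" "0 < M a c" | "0 < M b a" "0 < M b c" "0 < M c a"
      using same F sk by (auto simp: zero_less_mult_iff) (metis linorder_neqE_linordered_idom neg_0_less_iff_less)+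
    then show ?thesis
    proof cases
      case 1
      then show ?thesis using eq_chain[OF S M 1(3,2,1)] by simp
    next
      case 2
      then show ?thesis using eq_chain[OF S M 2(3,1,2)] by simp
    next
      case 3
      then show ?thesis using eq_chain[OF S M 3(1,3,2)] sk by simp
    next
      case 4
      then show ?thesis using eq_chain[OF S M 4(2,3,1)] sk by simp
    qed
  qed
qed simp

text \<open>Exchanging \<open>a\<close> with \<open>c\<close> and \<open>b\<close> with
  \<open>d\<close> keeps all signs among the four, since the cross entries vanish and the two
  remaining ones agree in sign; the inverse of the result is opposite to \<open>S\<close>.\<close>

lemma abs_eq_disjoint:
  assumes S: "S \<in> D" and M: "ssb_matrix M S" and pos: "0 < M a b * M c d"
    and z: "M a c = 0" "M a d = 0" "M b c = 0" "M b d = 0"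
  shows "\<bar>M a b\<bar> = \<bar>M c d\<bar>"
proof -
  have sk: "M x y = - M y x" for x y by (rule ssb_matrixD(1)[OF M])
  have nz: "M a b \<noteq> 0" "M c d \<noteq> 0" "M d c \<noteq> 0" using pos sk[of d c] by auto
  then have ne: "a \<noteq> b" "c \<noteq> d" "a \<noteq> c" "a \<noteq> d" "b \<noteq> c" "b \<noteq> d"
    using z ssb_matrixD(6)[OF M] by metis+
  define \<tau> where "\<tau> = Transposition.transpose a c"
  define \<rho> where "\<rho> = Transposition.transpose b d"
  define T where "T = perm_pref \<rho> (perm_pref \<tau> S)"
  define N where "N = (\<lambda>x y. M (\<tau> (\<rho> x)) (\<tau> (\<rho> y)))"
  have T1: "perm_pref \<tau> S \<in> D" "ssb_matrix (\<lambda>x y. M (\<tau> x) (\<tau> y)) (perm_pref \<tau> S)"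
    unfolding \<tau>_def using swap_matrix[OF S M] by auto
  have T: "T \<in> D" "ssb_matrix N T"
    unfolding T_def N_def \<rho>_def using swap_matrix[OF T1] by auto
  have tau: "\<tau> (\<rho> a) = c" "\<tau> (\<rho> b) = d" "\<tau> (\<rho> c) = a" "\<tau> (\<rho> d) = b"
    using ne by (auto simp: \<tau>_def \<rho>_def Transposition.transpose_def)
  have N: "N a b = M c d" "N c d = M a b" "N a c = 0" "N a d = 0" "N b c = 0" "N b d = 0"
    using z sk[of c a] sk[of c b] sk[of d a] sk[of d b] by (auto simp: N_def tau)
  note C = D_converse[OF T(1)] and CN = ssb_matrix_converse[OF T(2)]
  have base: "sgn (- N a b) = - sgn (M a b)" "sgn (- N c d) = - sgn (M c d)"
    "sgn (- N a c) = - sgn (M a c)" "sgn (- N a d) = - sgn (M a d)"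
    "sgn (- N b c) = - sgn (M b c)" "sgn (- N b d) = - sgn (M b d)"
    using pos z by (auto simp: N sgn_minus zero_less_mult_iff)
  note os = opposite_sym[OF M CN]
  have opp: "sgn (- N x y) = - sgn (M x y)" if "x \<in> {a, b, c, d}" "y \<in> {a, b, c, d}" for x y
    using that base os[OF base(1)] os[OF base(2)] os[OF base(3)] os[OF base(4)] os[OF base(5)]
      os[OF base(6)] ssb_matrixD(6)[OF M] ssb_matrixD(6)[OF T(2)] by auto
  have "- N a b * M c d = - N c d * M a b"
  proof (rule proportional_disjoint[where M = M and N = "\<lambda>a b. - N a b",
        OF ssb_matrixD(1)[OF M] ssb_matrixD(1)[OF CN]])
    show "bil (\<lambda>a b. - N a b) p q = 0"
      if "p \<in> Delta_on {a, b, c, d}" "q \<in> Delta_on {a, b, c, d}" "bil M p q = 0" for p q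
      using opposite_zero[OF S C M CN opp that] .
    show "M d b = 0" using z sk[of d b] by simp
  qed (use z pos in auto)
  then have "M a b * M a b = M c d * M c d" by (simp add: N)
  then show ?thesis by (rule square_eq_abs)
qed

text \<open>Nonzero entries are the edges of a graph. Adjacent edges have equal absolute value,
  hence so do edges joined by a third; edges without any link are the disjoint case, with
  \<open>c\<close>, \<open>d\<close> reversed if needed to match signs.\<close>

lemma abs_eq:
  assumes S: "S \<in> D" and M: "ssb_matrix M S" and nz: "M a b \<noteq> 0" "M c d \<noteq> 0"
  shows "\<bar>M a b\<bar> = \<bar>M c d\<bar>"
proof -
  have sk: "M x y = - M y x" for x y by (rule ssb_matrixD(1)[OF M])
  have abs: "\<bar>M x y\<bar> = \<bar>M y x\<bar>" for x y using sk[of x y] by simp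
  have nz': "M x y \<noteq> 0 \<longleftrightarrow> M y x \<noteq> 0" for x y using sk[of x y] by simp
  have adj: "\<bar>M x y\<bar> = \<bar>M z y\<bar>" if "M x y \<noteq> 0" "M z y \<noteq> 0" for x y z
    using abs_eq_adjacent[OF S M that] .
  have via: "\<bar>M x y\<bar> = \<bar>M z u\<bar>" if "M x y \<noteq> 0" "M z u \<noteq> 0" "M y u \<noteq> 0" for x y z u
    using adj[OF that(1), of u] adj[OF that(2,3)] that(3) nz'[of y u] abs[of y u] by simp
  show ?thesis
  proof (cases "M a c = 0 \<and> M a d = 0 \<and> M b c = 0 \<and> M b d = 0")
    case False
    have "\<bar>M a b\<bar> = \<bar>M c d\<bar>" if "M b d \<noteq> 0" using via[OF nz that] .
    moreover have "\<bar>M a b\<bar> = \<bar>M c d\<bar>" if "M b c \<noteq> 0"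
      using via[of a b d c] nz that nz'[of c d] abs[of c d] by simp
    moreover have "\<bar>M a b\<bar> = \<bar>M c d\<bar>" if "M a d \<noteq> 0"
      using via[of b a c d] nz that nz'[of a b] abs[of a b] by simp
    moreover have "\<bar>M a b\<bar> = \<bar>M c d\<bar>" if "M a c \<noteq> 0"
      using via[of b a d c] nz that nz'[of a b] abs[of a b] nz'[of c d] abs[of c d] by simp
    ultimately show ?thesis using False by blast
  next
    case True
    consider "0 < M a b * M c d" | "0 < M a b * M d c"
    proof -
      have "M a b * M d c = - (M a b * M c d)" by (simp add: sk[of d c])
      moreover have "M a b * M c d \<noteq> 0" using nz by simp
      ultimately have "0 < M a b * M c d \<or> 0 < M a b * M d c" by linarith
      then show thesis using that by blast
    qed
    then show ?thesis
    proof cases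
      case 1
      then show ?thesis using abs_eq_disjoint[OF S M 1] True by blast
    next
      case 2
      then show ?thesis using abs_eq_disjoint[OF S M 2] True abs[of c d] by simp
    qed
  qed
qed

end

section \<open>Normalisation to the values -1, 0, 1\<close>

lemma ssb_matrix_prefs_pc:
  assumes S: "S \<in> prefs" and M: "ssb_matrix M S"
    and eq: "\<And>a b c d. M a b \<noteq> 0 \<Longrightarrow> M c d \<noteq> 0 \<Longrightarrow> \<bar>M a b\<bar> = \<bar>M c d\<bar>"
  shows "S \<in> prefs_pc"
proof (cases "\<exists>a b. M a b \<noteq> 0")
  case False
  then have z: "bil M p q = 0" for p q by (simp add: bil_def)
  have "bil M \<in> Phi_pc"
    by (simp add: Phi_pc_def Phi_def ssb_def z)
  moreover have "represents (bil M) S" using ssb_matrixD(2)[OF M] by (simp add: represents_def)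
  ultimately show ?thesis using S by (auto simp: prefs_pc_def)
next
  case True
  then obtain a0 b0 where ab: "0 < M a0 b0"
    using ssb_matrixD(1)[OF M] by (metis linorder_neqE_linordered_idom neg_0_less_iff_less)
  define k where "k = M a0 b0"
  have k: "0 < k" using ab by (simp add: k_def)
  define \<phi> where "\<phi> p q = bil M p q / k" for p q
  have vals: "M a b \<in> {-k, 0, k}" for a b
    using eq[of a b a0 b0] ab by (cases "M a b = 0") (auto simp: k_def abs_if split: if_splits)
  \<comment> \<open>A bound on the entries bounds the form on all of \<open>Delta\<close>, so after
    division by \<open>k\<close> the largest value is \<open>1\<close>, attained at the pure
    outcomes \<open>a0\<close>, \<open>b0\<close>.\<close>
  have "M a b \<le> k" for a b using vals[of a b] k by auto
  then have le: "\<phi> p q \<le> 1" if "p \<in> Delta" "q \<in> Delta" for p q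
    using bil_le[OF _ that] k by (simp add: \<phi>_def)
  have "\<phi> p q = - \<phi> q p" for p q using ssb_matrixD(5)[OF M, of p q] by (simp add: \<phi>_def)
  moreover have "\<phi> (mix l p q) r = l * \<phi> p r + (1 - l) * \<phi> q r"
    "\<phi> r (mix l p q) = l * \<phi> r p + (1 - l) * \<phi> r q" for l p q r
    by (simp_all add: \<phi>_def bil_mix_left bil_mix_right add_divide_distrib)
  ultimately have "ssb \<phi>" unfolding ssb_def by blast
  moreover have "\<phi> (pure a0) (pure b0) = 1" using k by (simp add: \<phi>_def bil_pure k_def)
  ultimately have "\<phi> \<in> Phi" unfolding Phi_def using le pure_Delta by blast
  moreover have "\<phi> (pure a) (pure b) \<in> {-1, 0, 1}" for a b
    using vals[of a b] k by (auto simp: \<phi>_def bil_pure)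
  ultimately have "\<phi> \<in> Phi_pc" by (simp add: Phi_pc_def)
  moreover have "represents \<phi> S"
    using ssb_matrixD(2)[OF M] k by (simp add: represents_def \<phi>_def zero_less_divide_iff)
  ultimately show ?thesis using S by (auto simp: prefs_pc_def)
qed

theorem theorem1:
  fixes n :: nat
    and D :: "('a::finite) pref set"
    and f :: "(nat \<Rightarrow> 'a pref) \<Rightarrow> 'a pref"
  assumes "n \<ge> 2"
    and "CARD('a) \<ge> 4"
    and "D \<subseteq> prefs"
    and "rich D"
    and "swf n D f"
    and "arrovian n D f"
    and "anonymous n D f"
  shows "D \<subseteq> prefs_pc"
proof
  interpret anonymous_arrow n D f
    by (rule anonymous_arrow.intro) (rule assms)+
  fix S assume S: "S \<in> D"
  obtain M where M: "ssb_matrix M S" using matrix[OF D_prefs[OF S]] by blast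
  show "S \<in> prefs_pc"
    using ssb_matrix_prefs_pc[OF D_prefs[OF S] M abs_eq[OF S M]] .
qed

end
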